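(* Let $k\geq 2$. For any finite complex $\mathcal{X}$ with universal cover equal to the product of $k$ regular trees (a $k$-cube complex), there is a $k$-dimensional digraph $\mathrm{DG}(\mathcal{X})$ defined by sending each vertex of $\mathcal{X}$ to a vertex of $\mathrm{DG}(\mathcal{X})$, and by sending each geometric edge of $\mathcal{X}$ to two edges in the edge set of $\mathrm{DG}(\mathcal{X})$, of the same colour and opposite orientations.
   Context: A $k$-cube complex is a CW complex (cube complex) $\mathcal{X}$ whose universal cover is a Cartesian product $T_1\times\dots\times T_k$ of $k$ trees, each of finite constant valency, with its product cubical structure. $\mathcal{X}$ is taken to be finite, and the deck transformations do not interchange the tree factors, so that every geometric edge of $\mathcal{X}$ has a well-defined direction (colour) $i\in\{1,\dots,k\}$. A $k$-dimensional digraph $\mathrm{DG}=(V,E,o,t,k,\phi)$ ($k\ge2$) is a finite directed graph (finite vertex set $V$, finite edge set $E$, origin and terminus maps $o,t:E\to V$; loops and multiple edges allowed) with a decomposition $E=E_1\sqcup\dots\sqcup E_k$ (edges in $E_i$ have colour $i$) and a bijection $\phi:Y\to Y$ on the set $Y$ of all directed paths $xy$ of length two (so $t(x)=o(y)$) whose two edges have distinct colours, such that: (F1) If $xy\in Y$ with $x$ of colour $i$ and $y$ of colour $j$, $i\ne j$, then $\phi(xy)=y'x'$ for a unique pair $(y',x')$ with $y'$ of colour $j$, $x'$ of colour $i$, and the origin and terminus vertices of the paths $xy$ and $y'x'$ coincide. This is written $xy\sim y'x'$, and $\phi^2=1$. (F2) For all $x\in E_i$, $y\in E_j$, $z\in E_l$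 with $i,j,l$ distinct such that $xyz$ is a path: if $x_1,x_2,x^1,x^2\in E_i$, $y_1,y_2,y^1,y^2\in E_j$, $z_1,z_2,z^1,z^2\in E_l$ satisfy $xy\sim y^1x^1$, $x^1z\sim z^1x^2$, $y^1z^1\sim z^2y^2$ and $yz\sim z_1y_1$, $xz_1\sim z_2x_1$, $x_1y_1\sim y_2x_2$, then $x_2=x^2$, $y_2=y^2$, $z_2=z^2$. In $\mathrm{DG}(\mathcal{X})$ the vertex set is the vertex set of $\mathcal{X}$, $E_i$ is the set of oriented edges of $\mathcal{X}$ in direction $i$, and $\phi$ is read off from the squares: for a path $xy$ with $x\in E_i$, $y\in E_j$, $i\neq j$, there is a unique geometric square of $\mathcal{X}$ having $xy$ as two consecutive boundary edges, and $\phi(xy)=y'x'$ where $y'x'$ is the other boundary path of that square with the same origin and terminus, $x'\in E_i$, $y'\in E_j$. *)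

theory Defs
  imports "HOL-Analysis.Analysis" "Graph_Theory.Digraph"
begin

section \<open>Cubes\<close>

text \<open>The \<open>n\<close>-cube is realised in \<^typ>\<open>nat \<Rightarrow> real\<close> (with its product topology), using the
  coordinates \<open>0, \<dots>, n - 1\<close> and setting all further coordinates to \<open>0\<close>.\<close>

definition cube :: "nat \<Rightarrow> (nat \<Rightarrow> real) set" where
  "cube n = {f. (\<forall>i<n. 0 \<le> f i \<and> f i \<le> 1) \<and> (\<forall>i\<ge>n. f i = 0)}"

definition open_cube :: "nat \<Rightarrow> (nat \<Rightarrow> real) set" where
  "open_cube n = {f. (\<forall>i<n. 0 < f i \<and> f i < 1) \<and> (\<forall>i\<ge>n. f i = 0)}"

definition cube_symmetries :: "nat \<Rightarrow> ((nat \<Rightarrow> real) \<Rightarrow> (nat \<Rightarrow> real)) set" where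
  "cube_symmetries n =
     {s. \<exists>\<pi> r. \<pi> permutes {..<n} \<and>
        s = (\<lambda>f i. if i < n then (if r i then 1 - f (\<pi> i) else f (\<pi> i)) else 0)}"

text \<open>\<open>face_incl j e\<close> embeds the \<open>n\<close>-cube in the \<open>(n + 1)\<close>-cube as the face on which the
  \<open>j\<close>-th coordinate is \<open>e\<close>.\<close>

definition face_incl :: "nat \<Rightarrow> real \<Rightarrow> (nat \<Rightarrow> real) \<Rightarrow> (nat \<Rightarrow> real)" where
  "face_incl j e f = (\<lambda>i. if i < j then f i else if i = j then e else f (i - 1))"


section \<open>Cube complexes\<close>

text \<open>A cube complex is given by its underlying space, a subset of a topological space, together
  with the characteristic maps of its \<open>n\<close>-cells.  Each cell has one characteristic map for every
  symmetry of the cube, so that no orientation or ordering of coordinates is singled out.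
  Characteristic maps are extensional (\<open>undefined\<close> outside the cube), so that equality of
  characteristic maps is equality on the cube.\<close>

record 'a cubed_space =
  points :: "'a set"
  charmaps :: "nat \<Rightarrow> ((nat \<Rightarrow> real) \<Rightarrow> 'a) set"

text \<open>The clauses say that the space is Hausdorff; that characteristic maps are continuous, and
  injective on the open cube; that they are closed under symmetries and faces; that the open cells
  partition the space, with the characteristic maps of a cell differing only by a symmetry; and
  that the space carries the weak topology.  As every face of a cell is a cell, a cell has its
  boundary in finitely many cells of smaller dimension, so these are CW complexes.\<close>

definition cube_complex :: "'a::topological_space cubed_space \<Rightarrow> bool" where
  "cube_complex X \<longleftrightarrow>
     Hausdorff_space (top_of_set (points X)) \<and>
     (\<forall>n. \<forall>\<sigma>\<in>charmaps X n.
        \<sigma> \<in> extensional (cube n) \<and> continuous_on (cube n) \<sigma> \<and> \<sigma> ` cube n \<subseteq> points X \<and>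
        inj_on \<sigma> (open_cube n)) \<and>
     (\<forall>n. \<forall>\<sigma>\<in>charmaps X n. \<forall>s\<in>cube_symmetries n. restrict (\<sigma> \<circ> s) (cube n) \<in> charmaps X n) \<and>
     (\<forall>n. \<forall>\<sigma>\<in>charmaps X (Suc n). \<forall>j\<le>n. \<forall>e\<in>{0, 1}.
        restrict (\<sigma> \<circ> face_incl j e) (cube n) \<in> charmaps X n) \<and>
     points X = (\<Union>n. \<Union>\<sigma>\<in>charmaps X n. \<sigma> ` open_cube n) \<and>
     (\<forall>m n. \<forall>\<sigma>\<in>charmaps X m. \<forall>\<tau>\<in>charmaps X n.
        \<sigma> ` open_cube m \<inter> \<tau> ` open_cube n \<noteq> {} \<longrightarrow>
        m = n \<and> (\<exists>s\<in>cube_symmetries n. \<tau> = restrict (\<sigma> \<circ> s) (cube n))) \<and>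
     (\<forall>U\<subseteq>points X.
        (\<forall>n. \<forall>\<sigma>\<in>charmaps X n. openin (top_of_set (cube n)) (cube n \<inter> \<sigma> -` U)) \<longrightarrow>
        openin (top_of_set (points X)) U)"

text \<open>The geometric \<open>n\<close>-cubes are the open \<open>n\<close>-cells.\<close>

definition cells :: "'a cubed_space \<Rightarrow> nat \<Rightarrow> 'a set set" where
  "cells X n = {\<sigma> ` open_cube n | \<sigma>. \<sigma> \<in> charmaps X n}"

definition finite_complex :: "'a cubed_space \<Rightarrow> bool" where
  "finite_complex X \<longleftrightarrow> finite (\<Union>n. cells X n)"

definition vertices :: "'a cubed_space \<Rightarrow> 'a set" where
  "vertices X = {\<sigma> (\<lambda>_. 0) | \<sigma>. \<sigma> \<in> charmaps X 0}"

text \<open>An oriented edge is a characteristic map of a geometric edge; by \<^const>\<open>cube_complex\<close>, a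
  geometric edge has exactly two, which are the reverse of each other.\<close>

abbreviation oriented_edges :: "'a cubed_space \<Rightarrow> ((nat \<Rightarrow> real) \<Rightarrow> 'a) set" where
  "oriented_edges X \<equiv> charmaps X 1"

definition edge_origin :: "((nat \<Rightarrow> real) \<Rightarrow> 'a) \<Rightarrow> 'a" where
  "edge_origin x = x (\<lambda>_. 0)"

definition edge_terminus :: "((nat \<Rightarrow> real) \<Rightarrow> 'a) \<Rightarrow> 'a" where
  "edge_terminus x = x ((\<lambda>_. 0)(0 := 1))"

definition edge_reverse :: "((nat \<Rightarrow> real) \<Rightarrow> 'a) \<Rightarrow> ((nat \<Rightarrow> real) \<Rightarrow> 'a)" where
  "edge_reverse x = restrict (\<lambda>f. x ((\<lambda>_. 0)(0 := 1 - f 0))) (cube 1)"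


section \<open>Trees and their products\<close>

text \<open>A reduced path is a sequence of consecutive oriented edges without backtracking.\<close>

definition reduced_path :: "'a cubed_space \<Rightarrow> ((nat \<Rightarrow> real) \<Rightarrow> 'a) list \<Rightarrow> bool" where
  "reduced_path T xs \<longleftrightarrow>
     set xs \<subseteq> oriented_edges T \<and>
     (\<forall>m. Suc m < length xs \<longrightarrow>
        edge_terminus (xs ! m) = edge_origin (xs ! Suc m) \<and> xs ! Suc m \<noteq> edge_reverse (xs ! m))"

definition tree :: "'a::topological_space cubed_space \<Rightarrow> bool" where
  "tree T \<longleftrightarrow>
     cube_complex T \<and> (\<forall>n\<ge>2. charmaps T n = {}) \<and>
     points T \<noteq> {} \<and> connected (points T) \<and>
     \<not> (\<exists>xs. xs \<noteq> [] \<and> reduced_path T xs \<and> edge_terminus (last xs) = edge_origin (hd xs))"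

definition regular_tree :: "'a::topological_space cubed_space \<Rightarrow> bool" where
  "regular_tree T \<longleftrightarrow>
     tree T \<and>
     (\<exists>q. \<forall>v\<in>vertices T.
        finite {x \<in> oriented_edges T. edge_origin x = v} \<and>
        card {x \<in> oriented_edges T. edge_origin x = v} = q)"

text \<open>A product \<open>n\<close>-cube is the product of an edge of \<open>T i\<close> for \<open>n\<close> of the indices
  \<open>i \<in> {1..k}\<close> and of a vertex of \<open>T i\<close> for the others.  The injection \<open>c\<close> gives, for each
  coordinate of the cube, the tree in whose direction it runs; \<open>e i\<close> is the characteristic map
  of an edge or of a vertex of \<open>T i\<close>, as the case may be.\<close>

definition product_charmap ::
    "nat \<Rightarrow> (nat \<Rightarrow> 'b cubed_space) \<Rightarrow> nat \<Rightarrow> (nat \<Rightarrow> nat) \<Rightarrow> ((nat \<Rightarrow> real) \<Rightarrow> nat \<Rightarrow> 'b) \<Rightarrow> bool"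
  where
  "product_charmap k T n c \<sigma> \<longleftrightarrow>
     c ` {..<n} \<subseteq> {1..k} \<and> inj_on c {..<n} \<and>
     (\<exists>e. (\<forall>j<n. e (c j) \<in> charmaps (T (c j)) 1) \<and>
          (\<forall>i\<in>{1..k} - c ` {..<n}. e i \<in> charmaps (T i) 0) \<and>
          \<sigma> = (\<lambda>f\<in>cube n. \<lambda>i\<in>{1..k}.
                 if i \<in> c ` {..<n} then e i ((\<lambda>_. 0)(0 := f (the_inv_into {..<n} c i)))
                 else e i (\<lambda>_. 0)))"

definition tree_product :: "nat \<Rightarrow> (nat \<Rightarrow> 'b cubed_space) \<Rightarrow> (nat \<Rightarrow> 'b) cubed_space" where
  "tree_product k T =
     \<lparr>points = (\<Pi>\<^sub>E i\<in>{1..k}. points (T i)),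
      charmaps = (\<lambda>n. {\<sigma>. \<exists>c. product_charmap k T n c \<sigma>})\<rparr>"

definition product_edges ::
    "nat \<Rightarrow> (nat \<Rightarrow> 'b cubed_space) \<Rightarrow> nat \<Rightarrow> ((nat \<Rightarrow> real) \<Rightarrow> nat \<Rightarrow> 'b) set" where
  "product_edges k T i = {x. product_charmap k T 1 (\<lambda>_. i) x}"


section \<open>\<open>k\<close>-cube complexes\<close>

text \<open>The universal cover of a cube complex carries the lifted cubical structure, whose
  characteristic maps are all the lifts of those of the base.\<close>

definition cubical_universal_cover ::
    "'c::topological_space cubed_space \<Rightarrow> ('c \<Rightarrow> 'a) \<Rightarrow> 'a::topological_space cubed_space \<Rightarrow> bool"
  where
  "cubical_universal_cover C p X \<longleftrightarrow>
     covering_space (points C) p (points X) \<and> simply_connected (points C) \<and>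
     (\<forall>n. charmaps C n =
        {\<tau> \<in> extensional (cube n). continuous_on (cube n) \<tau> \<and> \<tau> ` cube n \<subseteq> points C \<and>
           restrict (p \<circ> \<tau>) (cube n) \<in> charmaps X n})"

definition deck_transformation ::
    "'c::topological_space set \<Rightarrow> ('c \<Rightarrow> 'a) \<Rightarrow> ('c \<Rightarrow> 'c) \<Rightarrow> bool" where
  "deck_transformation C p g \<longleftrightarrow> (\<exists>h. homeomorphism C C g h) \<and> (\<forall>z\<in>C. p (g z) = p z)"

definition preserves_factors ::
    "nat \<Rightarrow> (nat \<Rightarrow> 'b cubed_space) \<Rightarrow> ((nat \<Rightarrow> 'b) \<Rightarrow> (nat \<Rightarrow> 'b)) \<Rightarrow> bool" where
  "preserves_factors k T g \<longleftrightarrow>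
     (\<exists>\<gamma>. \<forall>z\<in>points (tree_product k T). \<forall>i\<in>{1..k}. g z i = \<gamma> i (z i))"

definition k_cube_complex ::
    "nat \<Rightarrow> (nat \<Rightarrow> 'b::topological_space cubed_space) \<Rightarrow> ((nat \<Rightarrow> 'b) \<Rightarrow> 'a) \<Rightarrow>
     'a::topological_space cubed_space \<Rightarrow> bool" where
  "k_cube_complex k T p X \<longleftrightarrow>
     cube_complex X \<and> finite_complex X \<and>
     (\<forall>i\<in>{1..k}. regular_tree (T i)) \<and>
     cubical_universal_cover (tree_product k T) p X \<and>
     (\<forall>g. deck_transformation (points (tree_product k T)) p g \<longrightarrow> preserves_factors k T g)"


section \<open>\<open>k\<close>-dimensional digraphs\<close>

record ('v, 'e) coloured_digraph =
  graph :: "('v, 'e) pre_digraph"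
  colour_class :: "nat \<Rightarrow> 'e set"
  path_swap :: "'e \<times> 'e \<Rightarrow> 'e \<times> 'e"

definition two_paths :: "nat \<Rightarrow> ('v, 'e) coloured_digraph \<Rightarrow> ('e \<times> 'e) set" where
  "two_paths k D =
     {(x, y). \<exists>i\<in>{1..k}. \<exists>j\<in>{1..k}. i \<noteq> j \<and> x \<in> colour_class D i \<and> y \<in> colour_class D j \<and>
        head (graph D) x = tail (graph D) y}"

definition F1 :: "nat \<Rightarrow> ('v, 'e) coloured_digraph \<Rightarrow> bool" where
  "F1 k D \<longleftrightarrow>
     (\<forall>i\<in>{1..k}. \<forall>j\<in>{1..k}. \<forall>x\<in>colour_class D i. \<forall>y\<in>colour_class D j.
        i \<noteq> j \<and> head (graph D) x = tail (graph D) y \<longrightarrow>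
        (\<exists>!(y', x'). path_swap D (x, y) = (y', x') \<and>
           y' \<in> colour_class D j \<and> x' \<in> colour_class D i \<and>
           head (graph D) y' = tail (graph D) x' \<and>
           tail (graph D) y' = tail (graph D) x \<and> head (graph D) x' = head (graph D) y) \<and>
        path_swap D (path_swap D (x, y)) = (x, y))"

text \<open>In the following, \<open>xa, xb\<close> stand for \<open>x\<^sup>1, x\<^sup>2\<close> and \<open>x1, x2\<close> for \<open>x\<^sub>1, x\<^sub>2\<close>,
  and similarly for \<open>y\<close> and \<open>z\<close>.\<close>

definition F2 :: "nat \<Rightarrow> ('v, 'e) coloured_digraph \<Rightarrow> bool" where
  "F2 k D \<longleftrightarrow>
     (\<forall>i\<in>{1..k}. \<forall>j\<in>{1..k}. \<forall>l\<in>{1..k}. i \<noteq> j \<and> j \<noteq> l \<and> i \<noteq> l \<longrightarrow>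
       (\<forall>x\<in>colour_class D i. \<forall>y\<in>colour_class D j. \<forall>z\<in>colour_class D l.
         head (graph D) x = tail (graph D) y \<and> head (graph D) y = tail (graph D) z \<longrightarrow>
         (\<forall>x1\<in>colour_class D i. \<forall>x2\<in>colour_class D i. \<forall>xa\<in>colour_class D i. \<forall>xb\<in>colour_class D i.
          \<forall>y1\<in>colour_class D j. \<forall>y2\<in>colour_class D j. \<forall>ya\<in>colour_class D j. \<forall>yb\<in>colour_class D j.
          \<forall>z1\<in>colour_class D l. \<forall>z2\<in>colour_class D l. \<forall>za\<in>colour_class D l. \<forall>zb\<in>colour_class D l.
            path_swap D (x, y) = (ya, xa) \<and> path_swap D (xa, z) = (za, xb) \<and>
            path_swap D (ya, za) = (zb, yb) \<and>
            path_swap D (y, z) = (z1, y1) \<and> path_swap D (x, z1) = (z2, x1) \<and>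
            path_swap D (x1, y1) = (y2, x2) \<longrightarrow>
            x2 = xb \<and> y2 = yb \<and> z2 = zb)))"

definition k_dim_digraph :: "nat \<Rightarrow> ('v, 'e) coloured_digraph \<Rightarrow> bool" where
  "k_dim_digraph k D \<longleftrightarrow>
     2 \<le> k \<and> fin_digraph (graph D) \<and>
     arcs (graph D) = (\<Union>i\<in>{1..k}. colour_class D i) \<and>
     disjoint_family_on (colour_class D) {1..k} \<and>
     bij_betw (path_swap D) (two_paths k D) (two_paths k D) \<and>
     F1 k D \<and> F2 k D"


section \<open>The digraph of a \<open>k\<close>-cube complex\<close>

text \<open>Boundary edges of a square, with coordinates \<open>0\<close> (horizontal) and \<open>1\<close> (vertical).  The
  paths \<open>bottom, right\<close> and \<open>left, top\<close> have the same origin and terminus.\<close>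

definition bottom_edge :: "((nat \<Rightarrow> real) \<Rightarrow> 'a) \<Rightarrow> ((nat \<Rightarrow> real) \<Rightarrow> 'a)" where
  "bottom_edge \<sigma> = restrict (\<sigma> \<circ> face_incl 1 0) (cube 1)"

definition top_edge :: "((nat \<Rightarrow> real) \<Rightarrow> 'a) \<Rightarrow> ((nat \<Rightarrow> real) \<Rightarrow> 'a)" where
  "top_edge \<sigma> = restrict (\<sigma> \<circ> face_incl 1 1) (cube 1)"

definition left_edge :: "((nat \<Rightarrow> real) \<Rightarrow> 'a) \<Rightarrow> ((nat \<Rightarrow> real) \<Rightarrow> 'a)" where
  "left_edge \<sigma> = restrict (\<sigma> \<circ> face_incl 0 0) (cube 1)"

definition right_edge :: "((nat \<Rightarrow> real) \<Rightarrow> 'a) \<Rightarrow> ((nat \<Rightarrow> real) \<Rightarrow> 'a)" where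
  "right_edge \<sigma> = restrict (\<sigma> \<circ> face_incl 0 1) (cube 1)"

text \<open>An oriented edge has direction \<open>i\<close> if it lifts to an edge of the product of trees in the
  direction of the \<open>i\<close>-th tree.  Every occurrence of a path \<open>xy\<close> as two consecutive boundary
  edges of a square becomes \<open>bottom, right\<close> for a suitable characteristic map of the square,
  which is why \<open>path_swap\<close> need only consider these.\<close>

definition DG ::
    "nat \<Rightarrow> (nat \<Rightarrow> 'b cubed_space) \<Rightarrow> ((nat \<Rightarrow> 'b) \<Rightarrow> 'a) \<Rightarrow> 'a cubed_space \<Rightarrow>
     ('a, (nat \<Rightarrow> real) \<Rightarrow> 'a) coloured_digraph" where
  "DG k T p X =
     \<lparr>graph = \<lparr>verts = vertices X, arcs = oriented_edges X, tail = edge_origin, head = edge_terminus\<rparr>,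
      colour_class = (\<lambda>i. {x \<in> oriented_edges X.
        \<exists>x'\<in>product_edges k T i. restrict (p \<circ> x') (cube 1) = x}),
      path_swap = (\<lambda>(x, y). THE q. \<exists>\<sigma>\<in>charmaps X 2.
        bottom_edge \<sigma> = x \<and> right_edge \<sigma> = y \<and> q = (left_edge \<sigma>, top_edge \<sigma>))\<rparr>"

end

theory Submission
  imports Defs
begin

text \<open>All cubes of the complex lift to the universal cover, where they are products of edges and vertices
  of the trees.  Each coordinate of such a product depends on at most one coordinate of the cube, so an
  edge upstairs has a direction, and a path of two edges in distinct directions spans exactly one square,
  a path of three edges a 3-cube.  The direction of an edge of the complex does not depend on its lift:
  two lifts differ by a deck transformation, which exists because the cover is simply connected and
  locally path connected, and deck transformations preserve the factors.  Axiom F1 is then the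
  existence and uniqueness of squares, and F2 compares the six faces of a 3-cube.\<close>

section \<open>Lifting cubes to a covering space\<close>

text \<open>The clause on \<open>charmaps\<close> in \<open>cubical_universal_cover\<close>
  describes the cubes upstairs twice: as products of edges and vertices, and as all lifts of cubes
  of \<open>X\<close>. The proof passes between the two. Closure under faces and reversal is
  inherited from \<open>X\<close> through lifts; directions and the filling of corners come from
  products. The link is rigidity: coordinate \<open>l\<close> of a product cube reads at most one
  coordinate of the cube, so the direction of an edge can be recognised from where the edge is
  constant. The obstacle is the colour of an edge downstairs, which is defined through some lift and
  could a priori differ for another one. Excluding this takes a deck transformation between the
  lifts, hence the long topological part. The spaces carry no metric and cubes live in a function
  space, so lifting, monodromy and deck transformations are derived directly from evenly covered
  neighbourhoods.\<close>

lemma product_neighbourhood_contains_box: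
  fixes x :: "nat \<Rightarrow> real"
  assumes W: "openin (top_of_set (cube n)) W" and x: "x \<in> W"
  obtains d where "d > 0" "\<And>f. f \<in> cube n \<Longrightarrow> (\<And>i. i < n \<Longrightarrow> \<bar>f i - x i\<bar> \<le> d) \<Longrightarrow> f \<in> W"
proof -
  obtain V where V: "open V" "W = cube n \<inter> V"
    using W by (auto simp: openin_open)
  have "openin (product_topology (\<lambda>i. euclidean) UNIV) V"
    using V(1) by (simp only: euclidean_product_topology open_openin)
  from product_topology_open_contains_basis[OF this] V(2) x
  obtain Y where Y: "x \<in> (\<Pi>\<^sub>E i\<in>UNIV. Y i)" "\<And>i. openin euclidean (Y i)" "(\<Pi>\<^sub>E i\<in>UNIV. Y i) \<subseteq> V"
    by (metis IntD2)
  have "\<exists>e>0. \<forall>t. \<bar>t - x i\<bar> \<le> e \<longrightarrow> t \<in> Y i" for i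
  proof -
    have "x i \<in> Y i" using Y(1) by auto
    then obtain e where "e > 0" "cball (x i) e \<subseteq> Y i"
      using Y(2) by (metis open_contains_cball open_openin)
    then show ?thesis
      by (intro exI[of _ e]) (auto simp: subset_iff dist_real_def abs_minus_commute)
  qed
  then obtain e where e: "\<And>i. e i > 0" "\<And>i t. \<bar>t - x i\<bar> \<le> e i \<Longrightarrow> t \<in> Y i"
    by metis
  \<comment> \<open>Only the finitely many coordinates below \<open>n\<close> matter, as the others
    vanish on the whole cube. The \<open>1\<close> keeps the minimum defined for
    \<open>n = 0\<close>.\<close>
  define d where "d = Min (insert 1 (e ` {..<n}))"
  have d: "d > 0" "\<And>i. i < n \<Longrightarrow> d \<le> e i"
    unfolding d_def using e(1) by (auto simp: Min_gr_iff intro: Min_le)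
  show ?thesis
  proof (rule that[OF d(1)])
    fix f assume f: "f \<in> cube n" and fx: "\<And>i. i < n \<Longrightarrow> \<bar>f i - x i\<bar> \<le> d"
    have "f i \<in> Y i" for i
    proof (cases "i < n")
      case True
      then show ?thesis using e(2) fx d(2) by (meson order_trans)
    next
      case False
      have "x \<in> cube n" using x V by auto
      then have "f i = x i" using f False by (auto simp: cube_def)
      then show ?thesis using e by (simp add: less_imp_le)
    qed
    then show "f \<in> W" using Y(3) V(2) f by auto
  qed
qed

text \<open>Convexity in coordinatewise form, since the ambient space is a function space. A segment
  is continuous because each of its coordinates is affine in \<open>t\<close>.\<close>

lemma path_connected_segments:
  fixes S :: "('i \<Rightarrow> real) set"
  assumes "\<And>f g t. f \<in> S \<Longrightarrow> g \<in> S \<Longrightarrow> 0 \<le> t \<Longrightarrow> t \<le> 1 \<Longrightarrow> (\<lambda>i. (1 - t) * f i + t * g i) \<in> S"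
  shows "path_connected S"
  unfolding path_connected_def
proof (intro ballI)
  fix f g assume fg: "f \<in> S" "g \<in> S"
  let ?h = "\<lambda>t i. (1 - t) * f i + t * g i"
  have "path ?h"
    unfolding path_def by (intro continuous_on_coordinatewise_then_product continuous_intros)
  moreover have "path_image ?h \<subseteq> S"
    using assms fg by (auto simp: path_image_def)
  ultimately show "\<exists>h. path h \<and> path_image h \<subseteq> S \<and> pathstart h = f \<and> pathfinish h = g"
    by (intro exI[of _ ?h]) (auto simp: pathstart_def pathfinish_def)
qed

lemma convex_combination_bounds:
  fixes a b t :: real
  assumes "0 \<le> t" "t \<le> 1" "lo \<le> a" "a \<le> hi" "lo \<le> b" "b \<le> hi"
  shows "lo \<le> (1 - t) * a + t * b" "(1 - t) * a + t * b \<le> hi"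
proof -
  have "(1 - t) * lo + t * lo \<le> (1 - t) * a + t * b"
    using assms by (intro add_mono mult_left_mono) auto
  then show "lo \<le> (1 - t) * a + t * b" by (simp add: algebra_simps)
  have "(1 - t) * a + t * b \<le> (1 - t) * hi + t * hi"
    using assms by (intro add_mono mult_left_mono) auto
  then show "(1 - t) * a + t * b \<le> hi" by (simp add: algebra_simps)
qed

text \<open>The bounds may lie outside the unit interval, so a box around a boundary point of the
  cube needs no separate treatment.\<close>

lemma path_connected_box:
  fixes lo hi :: "nat \<Rightarrow> real"
  shows "path_connected {f \<in> cube n. \<forall>i<n. lo i \<le> f i \<and> f i \<le> hi i}"
proof (rule path_connected_segments)
  fix f g and t :: real
  assume fg: "f \<in> {f \<in> cube n. \<forall>i<n. lo i \<le> f i \<and> f i \<le> hi i}"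
    "g \<in> {f \<in> cube n. \<forall>i<n. lo i \<le> f i \<and> f i \<le> hi i}" and t: "0 \<le> t" "t \<le> 1"
  have "0 \<le> (1 - t) * f i + t * g i" "(1 - t) * f i + t * g i \<le> 1"
    "lo i \<le> (1 - t) * f i + t * g i" "(1 - t) * f i + t * g i \<le> hi i" if "i < n" for i
    using fg that convex_combination_bounds[OF t, of 0 "f i" 1 "g i"]
      convex_combination_bounds[OF t, of "lo i" "f i" "hi i" "g i"] by (auto simp: cube_def)
  then show "(\<lambda>i. (1 - t) * f i + t * g i) \<in> {f \<in> cube n. \<forall>i<n. lo i \<le> f i \<and> f i \<le> hi i}"
    using fg by (simp add: cube_def)
qed

lemma closed_coordinate_le: "closed {f :: 'i \<Rightarrow> real. f i \<le> a}" "closed {f :: 'i \<Rightarrow> real. a \<le> f i}"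
  by (auto intro!: closed_Collect_le continuous_on_product_coordinates continuous_on_const)

lemma closed_cube: "closed (cube n)"
proof -
  have "cube n = (\<Inter>i\<in>{..<n}. {f. 0 \<le> f i} \<inter> {f. f i \<le> 1}) \<inter> (\<Inter>i\<in>{n..}. {f. 0 \<le> f i} \<inter> {f. f i \<le> 0})"
    by (auto simp: cube_def intro: antisym)
  also have "closed \<dots>"
    by (intro closed_Int closed_INT ballI closed_coordinate_le)
  finally show ?thesis .
qed

lemma closed_box:
  fixes lo hi :: "nat \<Rightarrow> real"
  shows "closed {f \<in> cube n. \<forall>i<n. lo i \<le> f i \<and> f i \<le> hi i}"
proof -
  have "{f \<in> cube n. \<forall>i<n. lo i \<le> f i \<and> f i \<le> hi i} =
    cube n \<inter> (\<Inter>i\<in>{..<n}. {f. lo i \<le> f i} \<inter> {f. f i \<le> hi i})"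
    by auto
  also have "closed \<dots>"
    by (intro closed_Int closed_INT ballI closed_coordinate_le closed_cube)
  finally show ?thesis .
qed

lemma path_connected_cube: "path_connected (cube n)"
proof -
  have "cube n = {f \<in> cube n. \<forall>i<n. 0 \<le> f i \<and> f i \<le> 1}"
    by (auto simp: cube_def)
  then show ?thesis using path_connected_box[of n "\<lambda>_. 0" "\<lambda>_. 1"] by simp
qed

lemma connected_cube: "connected (cube n)"
  by (simp add: path_connected_cube path_connected_imp_connected)

section \<open>Covering spaces: uniqueness and gluing of lifts\<close>

locale covering =
  fixes C :: "'c::topological_space set" and p :: "'c \<Rightarrow> 'a::topological_space" and S :: "'a set"
  assumes cov: "covering_space C p S"
begin

lemma p_cont: "continuous_on C p" and p_image: "p ` C = S"
  using cov by (auto simp: covering_space_def)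

text \<open>Both points lie over one evenly covered \<open>U\<close>, so each has a sheet over the
  same set. Distinct points of a fibre cannot share a sheet, where \<open>p\<close> is injective,
  and distinct sheets are disjoint. With \<open>c = d\<close> it supplies a neighbourhood on which
  \<open>p\<close> is injective.\<close>

lemma sheets:
  assumes "c \<in> C" "d \<in> C" "p c = p d"
  obtains U A B q r where "openin (top_of_set S) U" "p c \<in> U"
    "openin (top_of_set C) A" "openin (top_of_set C) B" "c \<in> A" "d \<in> B"
    "homeomorphism A U p q" "homeomorphism B U p r" "c \<noteq> d \<Longrightarrow> A \<inter> B = {}"
proof -
  obtain U v where U: "p c \<in> U" "openin (top_of_set S) U" and v: "\<Union>v = C \<inter> p -` U"
    "\<And>u. u \<in> v \<Longrightarrow> openin (top_of_set C) u" "pairwise disjnt v"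
    "\<And>u. u \<in> v \<Longrightarrow> \<exists>q. homeomorphism u U p q"
    using cov assms(1) unfolding covering_space_def by (metis image_eqI)
  obtain A B where AB: "A \<in> v" "c \<in> A" "B \<in> v" "d \<in> B"
    using v(1) U(1) assms by (metis IntI UnionE vimageI)
  then obtain q r where qr: "homeomorphism A U p q" "homeomorphism B U p r"
    using v(4) by blast
  have "A \<inter> B = {}" if "c \<noteq> d"
  proof -
    have "A \<noteq> B"
      using qr AB that assms(3) by (metis homeomorphism_apply1)
    then show ?thesis using v(3) AB by (metis disjnt_def pairwiseD)
  qed
  with that U v(2) AB qr show ?thesis by blast
qed

text \<open>The sets of agreement and of disagreement are both open in the connected
  \<open>T\<close>. Openness of the latter comes from disjoint sheets, not from a separation
  property of \<open>C\<close>.\<close>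

lemma lift_unique:
  assumes g: "continuous_on T g" "g ` T \<subseteq> C" and h: "continuous_on T h" "h ` T \<subseteq> C"
    and gh: "\<And>y. y \<in> T \<Longrightarrow> p (g y) = p (h y)"
    and T: "connected T" "a \<in> T" "g a = h a" and "x \<in> T"
  shows "g x = h x"
proof -
  have pre: "openin (top_of_set T) {y \<in> T. g y \<in> A \<and> h y \<in> B}"
    if "openin (top_of_set C) A" "openin (top_of_set C) B" for A B
  proof -
    have "openin (top_of_set T) (T \<inter> g -` A)" "openin (top_of_set T) (T \<inter> h -` B)"
      using g h that by (auto intro: continuous_openin_preimage)
    then have "openin (top_of_set T) ((T \<inter> g -` A) \<inter> (T \<inter> h -` B))" by blast
    moreover have "(T \<inter> g -` A) \<inter> (T \<inter> h -` B) = {y \<in> T. g y \<in> A \<and> h y \<in> B}" by blast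
    ultimately show ?thesis by simp
  qed
  let ?E = "{y \<in> T. g y = h y}" and ?D = "{y \<in> T. g y \<noteq> h y}"
  have "openin (top_of_set T) ?E"
  proof (subst openin_subopen, intro ballI)
    fix y assume y: "y \<in> ?E"
    then have "g y \<in> C" using g(2) by blast
    from sheets[OF this this refl]
    obtain U A q where A: "openin (top_of_set C) A" "g y \<in> A" "homeomorphism A U p q"
      by (metis (no_types, lifting))
    have "g z = h z" if "z \<in> T" "g z \<in> A" "h z \<in> A" for z
      using A(3) gh[OF that(1)] that by (metis homeomorphism_apply1)
    then have "{z \<in> T. g z \<in> A \<and> h z \<in> A} \<subseteq> ?E" by blast
    then show "\<exists>W. openin (top_of_set T) W \<and> y \<in> W \<and> W \<subseteq> ?E"
      using pre[OF A(1) A(1)] A y by (intro exI[of _ "{z \<in> T. g z \<in> A \<and> h z \<in> A}"]) auto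
  qed
  moreover have "openin (top_of_set T) ?D"
  proof (subst openin_subopen, intro ballI)
    fix y assume y: "y \<in> ?D"
    then have "g y \<in> C" "h y \<in> C" "p (g y) = p (h y)" "g y \<noteq> h y" using g(2) h(2) gh by auto
    from sheets[OF this(1-3)] this(4)
    obtain A B where A: "openin (top_of_set C) A" "g y \<in> A" "openin (top_of_set C) B" "h y \<in> B"
      "A \<inter> B = {}"
      by (metis (no_types, lifting))
    then have "{z \<in> T. g z \<in> A \<and> h z \<in> B} \<subseteq> ?D" by auto
    then show "\<exists>W. openin (top_of_set T) W \<and> y \<in> W \<and> W \<subseteq> ?D"
      using pre[OF A(1) A(3)] A y by (intro exI[of _ "{z \<in> T. g z \<in> A \<and> h z \<in> B}"]) auto
  qed
  moreover have "?E \<union> ?D = T" "?E \<inter> ?D = {}" by auto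
  ultimately have "?E = {} \<or> ?D = {}"
    using T(1) unfolding connected_openin by blast
  then show ?thesis using assms by auto
qed

text \<open>A lift is demanded through every point of the fibre over every base point, not just some
  lift. Gluing needs this strength: the lift over one piece prescribes the value at a common point
  with the next.\<close>

definition liftable :: "('z::topological_space \<Rightarrow> 'a) \<Rightarrow> 'z set \<Rightarrow> bool" where
  "liftable f T \<longleftrightarrow> (\<forall>s\<in>T. \<forall>c\<in>C. p c = f s \<longrightarrow>
     (\<exists>g. continuous_on T g \<and> g ` T \<subseteq> C \<and> g s = c \<and> (\<forall>y\<in>T. p (g y) = f y)))"

lemma liftable_subset: "liftable f T \<Longrightarrow> T' \<subseteq> T \<Longrightarrow> liftable f T'"
  unfolding liftable_def by (meson continuous_on_subset image_mono order_trans subsetD)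

text \<open>Lift over \<open>T\<close>, then restart over \<open>T'\<close> at the common point
  \<open>u\<close>. The two lifts agree on the connected intersection by uniqueness, and closedness
  of the pieces makes the combined map continuous.\<close>

lemma liftable_UnI:
  assumes T: "closed T" "closed T'" "connected (T \<inter> T')" "u \<in> T" "u \<in> T'"
    and lift: "liftable f T" "liftable f T'"
  shows "liftable f (T \<union> T')"
proof -
  \<comment> \<open>Stated afresh for all \<open>T\<close>, \<open>T'\<close> with the base point in
    the first piece; exchanging the pieces then handles a base point in \<open>T'\<close>.\<close>
  have *: "\<exists>g. continuous_on (T \<union> T') g \<and> g ` (T \<union> T') \<subseteq> C \<and> g s = c \<and> (\<forall>y\<in>T \<union> T'. p (g y) = f y)"
    if T: "closed T" "closed T'" "connected (T \<inter> T')" "u \<in> T" "u \<in> T'"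
      and lift: "liftable f T" "liftable f T'" and s: "s \<in> T" "c \<in> C" "p c = f s" for s c T T'
  proof -
    obtain g where g: "continuous_on T g" "g ` T \<subseteq> C" "g s = c" "\<And>y. y \<in> T \<Longrightarrow> p (g y) = f y"
      using lift(1) s unfolding liftable_def by meson
    have "g u \<in> C" "p (g u) = f u" using g T by auto
    then obtain h where h: "continuous_on T' h" "h ` T' \<subseteq> C" "h u = g u" "\<And>y. y \<in> T' \<Longrightarrow> p (h y) = f y"
      using lift(2) T(5) unfolding liftable_def by meson
    have eq: "g y = h y" if "y \<in> T \<inter> T'" for y
    proof (rule lift_unique[of "T \<inter> T'" g h u])
      show "continuous_on (T \<inter> T') g" "continuous_on (T \<inter> T') h"
        using g(1) h(1) by (auto intro: continuous_on_subset)
    qed (use g h T that in auto)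
    let ?G = "\<lambda>y. if y \<in> T then g y else h y"
    have "continuous_on (T \<union> T') ?G"
      by (rule continuous_on_cases) (use T g h eq in auto)
    moreover have "?G ` (T \<union> T') \<subseteq> C" "?G s = c" "\<forall>y\<in>T \<union> T'. p (?G y) = f y"
      using g h s by auto
    ultimately show ?thesis by blast
  qed
  have cm: "connected (T' \<inter> T)" using T(3) by (simp add: Int_commute)
  show ?thesis
    unfolding liftable_def
    using *[OF T lift] *[OF T(2,1) cm T(5,4) lift(2,1)] by (metis Un_iff Un_commute)
qed

text \<open>Over an evenly covered \<open>U\<close>, the lift through \<open>c\<close> is
  \<open>f\<close> followed by the inverse of \<open>p\<close> on the sheet that contains
  \<open>c\<close>.\<close>

lemma liftable_evenly_covered:
  assumes f: "continuous_on D f" "f ` D \<subseteq> S" and x: "x \<in> D"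
  obtains W where "openin (top_of_set D) W" "x \<in> W" "liftable f W"
proof -
  obtain U v where U: "f x \<in> U" "openin (top_of_set S) U" and v: "\<Union>v = C \<inter> p -` U"
    "\<And>u. u \<in> v \<Longrightarrow> \<exists>q. homeomorphism u U p q"
    using cov f(2) x unfolding covering_space_def by (metis image_subset_iff)
  have "liftable f (D \<inter> f -` U)"
    unfolding liftable_def
  proof (intro ballI impI)
    fix s c assume s: "s \<in> D \<inter> f -` U" "c \<in> C" "p c = f s"
    then obtain A q where A: "A \<in> v" "c \<in> A" and q: "homeomorphism A U p q"
      using v by (metis IntD2 IntI UnionE vimageD vimageI)
    have "A \<subseteq> C" using A v(1) by blast
    have "continuous_on (D \<inter> f -` U) (q \<circ> f)"
      using q f(1) by (intro continuous_on_compose) (auto simp: homeomorphism_def intro: continuous_on_subset)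
    moreover have "(q \<circ> f) ` (D \<inter> f -` U) \<subseteq> C" "(q \<circ> f) s = c" "\<forall>y\<in>D \<inter> f -` U. p ((q \<circ> f) y) = f y"
      using q s A \<open>A \<subseteq> C\<close> by (auto simp: homeomorphism_def)
    ultimately show "\<exists>g. continuous_on (D \<inter> f -` U) g \<and> g ` (D \<inter> f -` U) \<subseteq> C \<and> g s = c \<and>
        (\<forall>y\<in>D \<inter> f -` U. p (g y) = f y)" by blast
  qed
  moreover have "openin (top_of_set D) (D \<inter> f -` U)"
    using f U by (auto intro: continuous_openin_preimage)
  ultimately show ?thesis using that U(1) x by blast
qed

text \<open>Boxes with a lift are enlarged by one coordinate at a time: around each point, bisection along
  the next coordinate glues finitely many of them.\<close>

lemma liftable_cube:
  assumes f: "continuous_on (cube n) f" "f ` cube n \<subseteq> S"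
  shows "liftable f (cube n)"
proof -
  \<comment> \<open>The coordinates below \<open>m\<close> are unrestricted in
    \<open>?B m d x\<close>. So \<open>m = 0\<close> is a small box around \<open>x\<close>, and
    \<open>m = n\<close> is the whole cube.\<close>
  let ?B = "\<lambda>m d x. {g \<in> cube n. \<forall>i<n. m \<le> i \<longrightarrow> \<bar>g i - x i\<bar> \<le> d}"
  have "\<forall>x\<in>cube n. \<exists>d>0. liftable f (?B m d x)" if "m \<le> n" for m
    using that
  proof (induction m)
    case 0
    show ?case
    proof
      fix x assume "x \<in> cube n"
      then obtain W where W: "openin (top_of_set (cube n)) W" "x \<in> W" "liftable f W"
        using liftable_evenly_covered[OF f] by metis
      then obtain d where "d > 0" "\<And>g. g \<in> cube n \<Longrightarrow> (\<And>i. i < n \<Longrightarrow> \<bar>g i - x i\<bar> \<le> d) \<Longrightarrow> g \<in> W"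
        using product_neighbourhood_contains_box by metis
      then show "\<exists>d>0. liftable f (?B 0 d x)"
        by (intro exI[of _ d]) (auto intro!: liftable_subset[OF W(3)])
    qed
  next
    case (Suc m)
    show ?case
    proof
      fix x assume x: "x \<in> cube n"
      let ?Q = "\<lambda>a b d. {g \<in> ?B (Suc m) d x. a \<le> g m \<and> g m \<le> b}"
      have Q: "?Q a b d = {g \<in> cube n. \<forall>i<n. (if i < m then 0 else if i = m then a else x i - d) \<le> g i
          \<and> g i \<le> (if i < m then 1 else if i = m then b else x i + d)}" for a b d
        using Suc.prems by (auto simp: abs_le_iff cube_def Suc_le_eq not_less split: if_splits; force)
      \<comment> \<open>The guard keeps every division point \<open>b\<close> inside the unit
        interval, so that \<open>x(m := b)\<close> lies in the cube and is a common point of the two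
        slabs to be glued.\<close>
      define P where "P = (\<lambda>a b. 0 \<le> a \<and> b \<le> 1 \<longrightarrow> (\<exists>d>0. liftable f (?Q a b d)))"
      have "P 0 1"
      proof (rule Bolzano[of "0::real" 1 P])
        show "(0::real) \<le> 1" by simp
      next
        fix a b c assume ab: "P a b" "P b c" "a \<le> b" "b \<le> c"
        show "P a c"
          unfolding P_def
        proof (intro impI)
          assume ac: "0 \<le> a \<and> c \<le> 1"
          then obtain d1 d2 where d: "d1 > 0" "liftable f (?Q a b d1)" "d2 > 0" "liftable f (?Q b c d2)"
            using ab unfolding P_def by (meson order_trans)
          define d where "d = min d1 d2"
          have "liftable f (?Q a b d \<union> ?Q b c d)"
          proof (rule liftable_UnI[of _ _ "x(m := b)"])
            show "closed (?Q a b d)" "closed (?Q b c d)"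
              unfolding Q by (rule closed_box)+
            have "?Q a b d \<inter> ?Q b c d = ?Q b b d" using ab by auto
            then show "connected (?Q a b d \<inter> ?Q b c d)"
              unfolding Q by (simp only: path_connected_imp_connected[OF path_connected_box])
            have "x(m := b) \<in> cube n" using x ac ab Suc.prems by (auto simp: cube_def)
            then show "x(m := b) \<in> ?Q a b d" "x(m := b) \<in> ?Q b c d"
              using ab d unfolding d_def by auto
            show "liftable f (?Q a b d)" "liftable f (?Q b c d)"
              by (rule liftable_subset[OF d(2)], force simp: d_def, rule liftable_subset[OF d(4)], force simp: d_def)
          qed
          then have "liftable f (?Q a c d)"
            by (rule liftable_subset) (use ab in auto)
          then show "\<exists>d>0. liftable f (?Q a c d)"
            using d(1,3) by (intro exI[of _ d]) (simp add: d_def)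
        qed
      next
        fix t :: real assume t: "0 \<le> t" "t \<le> 1"
        then have "x(m := t) \<in> cube n" using x Suc.prems by (auto simp: cube_def)
        then obtain d where d: "d > 0" "liftable f (?B m d (x(m := t)))"
          using bspec[OF Suc.IH[OF Suc_leD[OF Suc.prems]]] by blast
        \<comment> \<open>The induction hypothesis at \<open>x(m := t)\<close> gives a box of radius
          \<open>d\<close>, which contains every slab around \<open>t\<close> thinner than
          \<open>d\<close>.\<close>
        have "P a b" if "a \<le> t" "t \<le> b" "b - a < d" for a b
          unfolding P_def
        proof (intro impI exI[of _ d] conjI d(1) liftable_subset[OF d(2)])
          show "?Q a b d \<subseteq> ?B m d (x(m := t))"
            using that by (auto simp: abs_le_iff)
        qed
        then show "\<exists>d>0. \<forall>a b. a \<le> t \<and> t \<le> b \<and> b - a < d \<longrightarrow> P a b"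
          using d(1) by blast
      qed
      then obtain d where "d > 0" "liftable f (?Q 0 1 d)" unfolding P_def by auto
      then show "\<exists>d>0. liftable f (?B (Suc m) d x)"
        using Suc.prems by (intro exI[of _ d] conjI) (auto elim!: liftable_subset simp: cube_def)
    qed
  qed
  from bspec[OF this[OF order_refl], of "\<lambda>_. 0"] obtain d where "liftable f (?B n d (\<lambda>_. 0))"
    by (auto simp: cube_def)
  then show ?thesis by (rule liftable_subset) auto
qed

end

section \<open>Deck transformations of simply connected coverings\<close>

lemma segment_in_cube:
  "0 \<le> t \<Longrightarrow> t \<le> 1 \<Longrightarrow> (\<lambda>_. 0)(0 := t) \<in> cube 1"
  "0 \<le> s \<Longrightarrow> s \<le> 1 \<Longrightarrow> 0 \<le> t \<Longrightarrow> t \<le> 1 \<Longrightarrow> (\<lambda>_. 0)(0 := s, 1 := t) \<in> cube 2"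
  by (auto simp: cube_def)

lemma cube_coordinate: "f \<in> cube n \<Longrightarrow> 0 \<le> f i" "f \<in> cube n \<Longrightarrow> f i \<le> 1"
  by (cases "i < n"; simp add: cube_def)+

lemma continuous_on_coordinates_2:
  assumes "continuous_on D u" "continuous_on D v"
  shows "continuous_on D (\<lambda>x. (\<lambda>_. 0 :: real)(0 := u x, (1::nat) := v x))"
proof (rule continuous_on_coordinatewise_then_product)
  fix i :: nat
  show "continuous_on D (\<lambda>x. ((\<lambda>_. 0)(0 := u x, 1 := v x)) i)"
    by (cases "i = 0"; cases "i = 1") (use assms in auto)
qed

lemma continuous_on_coordinates_1:
  assumes "continuous_on D u"
  shows "continuous_on D (\<lambda>x. (\<lambda>_. 0 :: real)((0::nat) := u x))"
proof (rule continuous_on_coordinatewise_then_product)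
  fix i :: nat
  show "continuous_on D (\<lambda>x. ((\<lambda>_. 0)(0 := u x)) i)"
    by (cases "i = 0") (use assms in auto)
qed

context covering
begin

text \<open>A path is read as a map on the 1-cube through coordinate \<open>0\<close>, so that
  \<open>liftable_cube\<close> covers path lifting as well.\<close>

lemma lift_path:
  assumes \<gamma>: "path \<gamma>" "path_image \<gamma> \<subseteq> S" and c: "c \<in> C" "p c = pathstart \<gamma>"
  obtains \<delta> where "path \<delta>" "path_image \<delta> \<subseteq> C" "pathstart \<delta> = c" "\<And>t. t \<in> {0..1} \<Longrightarrow> p (\<delta> t) = \<gamma> t"
proof -
  let ?f = "\<lambda>x :: nat \<Rightarrow> real. \<gamma> (x 0)"
  have "liftable ?f (cube 1)"
  proof (rule liftable_cube)
    show "continuous_on (cube 1) ?f"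
      using \<gamma>(1) unfolding path_def
      by (rule continuous_on_compose2)
        (auto simp: cube_coordinate intro: continuous_on_subset[OF continuous_on_product_coordinates])
    show "?f ` cube 1 \<subseteq> S"
      using \<gamma>(2) by (auto simp: path_image_def cube_coordinate image_subset_iff)
  qed
  moreover have "(\<lambda>_. 0) \<in> cube 1" by (simp add: cube_def)
  ultimately obtain g where g: "continuous_on (cube 1) g" "g ` cube 1 \<subseteq> C" "g (\<lambda>_. 0) = c"
    "\<And>y. y \<in> cube 1 \<Longrightarrow> p (g y) = \<gamma> (y 0)"
    using c unfolding liftable_def by (auto simp: pathstart_def) metis
  let ?d = "\<lambda>t. g ((\<lambda>_. 0)(0 := t))"
  show ?thesis
  proof (rule that[of ?d])
    show "path ?d"
      unfolding path_def
      by (rule continuous_on_compose2[OF g(1)])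
        (use segment_in_cube(1) in \<open>auto intro!: continuous_on_coordinates_1 simp del: fun_upd_apply One_nat_def\<close>)
    show "path_image ?d \<subseteq> C"
      using g(2) segment_in_cube(1) by (auto simp: path_image_def image_subset_iff simp del: One_nat_def)
    have "(\<lambda>_. 0 :: real)((0::nat) := 0) = (\<lambda>_. 0)" by auto
    then show "pathstart ?d = c" using g(3) by (simp add: pathstart_def)
    show "p (?d t) = \<gamma> t" if "t \<in> {0..1}" for t
      using g(4)[OF segment_in_cube(1)] that by simp
  qed
qed

end

text \<open>The base is locally path connected by \<open>lpc\<close>. This gives the continuity of
  transport along paths, by way of \<open>joint_paths_local\<close>.\<close>

locale simply_connected_covering = covering C p S
  for C :: "'c::topological_space set" and p :: "'c \<Rightarrow> 'a::topological_space" and S :: "'a set" +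
  assumes sc: "simply_connected C"
    and lpc: "\<And>U x. openin (top_of_set S) U \<Longrightarrow> x \<in> U \<Longrightarrow>
      \<exists>N. openin (top_of_set S) N \<and> x \<in> N \<and> N \<subseteq> U \<and> path_connected N"
begin

text \<open>\<open>simply_connected\<close> says that any two loops are freely homotopic. For
  constant loops at \<open>a\<close> and \<open>b\<close>, the track of the base point during the
  homotopy is a path between them.\<close>

lemma path_connected_cover: "path_connected C"
  unfolding path_connected_def
proof (intro ballI)
  fix a b assume ab: "a \<in> C" "b \<in> C"
  have "homotopic_loops C (\<lambda>_. a) (\<lambda>_. b)"
    by (rule sc[unfolded simply_connected_def, rule_format])
      (use ab in \<open>auto simp: path_def path_image_def pathstart_def pathfinish_def\<close>)
  then obtain h :: "real \<times> real \<Rightarrow> 'c" where h: "continuous_on ({0..1} \<times> {0..1}) h" "h \<in> ({0..1} \<times> {0..1}) \<rightarrow> C"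
    "h (0, 0) = a" "h (1, 0) = b"
    unfolding homotopic_loops by fastforce
  have "path (\<lambda>s. h (s, 0))"
    unfolding path_def by (rule continuous_on_compose2[OF h(1)]) (auto intro!: continuous_intros)
  then show "\<exists>g. path g \<and> path_image g \<subseteq> C \<and> pathstart g = a \<and> pathfinish g = b"
    using h by (intro exI[of _ "\<lambda>s. h (s, 0)"]) (auto simp: path_image_def pathstart_def pathfinish_def)
qed

text \<open>The lifted null homotopy has its two vertical sides over the same path, and they agree at the
  end where the homotopy has become constant.\<close>

lemma loop_over_image_of_loop:
  assumes l: "path l" "path_image l \<subseteq> C" "pathfinish l = pathstart l"
    and e: "path e" "path_image e \<subseteq> C" and le: "\<And>t. t \<in> {0..1} \<Longrightarrow> p (e t) = p (l t)"
  shows "pathfinish e = pathstart e"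
proof -
  have e01: "e t \<in> C" "l t \<in> C" if "t \<in> {0..1}" for t
    using e(2) l(2) that by (auto simp: path_image_def)
  define a where "a = l 0"
  have "homotopic_loops C l (\<lambda>_. a)"
    by (rule sc[unfolded simply_connected_def, rule_format])
      (use l e01[of 0] in \<open>auto simp: a_def path_def path_image_def pathstart_def pathfinish_def\<close>)
  then obtain h :: "real \<times> real \<Rightarrow> 'c" where h: "continuous_on ({0..1} \<times> {0..1}) h" "h \<in> ({0..1} \<times> {0..1}) \<rightarrow> C"
    and h0: "\<And>t. t \<in> {0..1} \<Longrightarrow> h (0, t) = l t" and h1: "\<And>t. t \<in> {0..1} \<Longrightarrow> h (1, t) = a"
    and hs: "\<And>s. s \<in> {0..1} \<Longrightarrow> h (s, 1) = h (s, 0)"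
    unfolding homotopic_loops by (auto simp: pathstart_def pathfinish_def)
  have hC: "h (s, t) \<in> C" if "s \<in> {0..1}" "t \<in> {0..1}" for s t
    using h(2) that by auto
  \<comment> \<open>The null homotopy is projected to the base and lifted anew, now starting at
    \<open>e 0\<close> instead of \<open>l 0\<close>.\<close>
  let ?f = "\<lambda>x :: nat \<Rightarrow> real. p (h (x 0, x 1))"
  have "liftable ?f (cube 2)"
  proof (rule liftable_cube)
    have "continuous_on (cube 2) (\<lambda>x. h (x 0, x 1))"
      by (rule continuous_on_compose2[OF h(1)])
        (auto intro!: continuous_intros continuous_on_subset[OF continuous_on_product_coordinates] simp: cube_coordinate)
    moreover have sub: "(\<lambda>x. h (x 0, x 1)) ` cube 2 \<subseteq> C"
      using hC by (auto simp: cube_coordinate)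
    ultimately show "continuous_on (cube 2) ?f"
      by (rule continuous_on_compose2[OF p_cont])
    show "?f ` cube 2 \<subseteq> S"
      using sub p_image by auto
  qed
  moreover have "(\<lambda>_. 0) \<in> cube 2" by (simp add: cube_def)
  moreover have "p (e 0) = ?f (\<lambda>_. 0)" using h0 le by simp
  ultimately obtain g where g: "continuous_on (cube 2) g" "g ` cube 2 \<subseteq> C" "g (\<lambda>_. 0) = e 0"
    "\<And>y. y \<in> cube 2 \<Longrightarrow> p (g y) = p (h (y 0, y 1))"
    using e01[of 0] unfolding liftable_def by (metis atLeastAtMost_iff order_refl zero_le_one)
  define G where "G s t = g ((\<lambda>_. 0)(0 := s, 1 := t))" for s t
  have G: "G s t \<in> C" "p (G s t) = p (h (s, t))" if "s \<in> {0..1}" "t \<in> {0..1}" for s t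
    using that g(2) g(4)[of "(\<lambda>_. 0)(0 := s, 1 := t)"] segment_in_cube(2)[of s t] by (auto simp: G_def)
  have G00: "G 0 0 = e 0"
  proof -
    have "(\<lambda>_. 0 :: real)((0::nat) := 0, 1 := 0) = (\<lambda>_. 0)" by auto
    then show ?thesis using g(3) by (simp add: G_def)
  qed
  have cG: "continuous_on {0..1} (\<lambda>x. G (u x) (v x))"
    if "continuous_on {0..1} u" "continuous_on {0..1} v" "\<And>t. t \<in> {0..1} \<Longrightarrow> u t \<in> {0..1}" "\<And>t. t \<in> {0..1} \<Longrightarrow> v t \<in> {0..1}"
    for u v :: "real \<Rightarrow> real"
    unfolding G_def
  proof (rule continuous_on_compose2[OF g(1) continuous_on_coordinates_2[OF that(1,2)]])
    show "(\<lambda>x. (\<lambda>_. 0)(0 := u x, 1 := v x)) ` {0..1} \<subseteq> cube 2"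
      by (intro image_subsetI segment_in_cube(2)) (use that(3,4) in auto)
  qed
  have conn: "connected {0..1::real}" by simp
  have uniq: "f 1 = f' 1" if "continuous_on {0..1} f" "f ` {0..1} \<subseteq> C" "continuous_on {0..1} f'" "f' ` {0..1} \<subseteq> C"
      "\<And>t. t \<in> {0..1} \<Longrightarrow> p (f t) = p (f' t)" "f 0 = f' 0" for f f' :: "real \<Rightarrow> 'c"
    by (rule lift_unique[OF that(1-5) conn _ that(6)]) auto
  \<comment> \<open>At \<open>s = 0\<close> the new lift lies over the image of \<open>l\<close>, as
    \<open>e\<close> does, and starts where \<open>e\<close> starts.\<close>
  have bottom: "G 0 1 = e 1"
    by (rule uniq) (use e01 e(1) G le h0 G00 cG[of "\<lambda>_. 0" "\<lambda>t. t"] in \<open>auto simp: path_def\<close>)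
  have top: "G 1 1 = G 1 0"
    by (rule uniq[of "\<lambda>t. G 1 t" "\<lambda>t. G 1 0"]) (use G h1 cG[of "\<lambda>_. 1" "\<lambda>t. t"] in \<open>auto\<close>)
  \<comment> \<open>\<open>uniq\<close> starts from parameter \<open>0\<close>, whereas the two
    sides are known to agree at \<open>s = 1\<close>; so they are run backwards.\<close>
  have "G (1 - 1) 1 = G (1 - 1) 0"
  proof (rule uniq[of "\<lambda>s. G (1 - s) 1" "\<lambda>s. G (1 - s) 0"])
    show "continuous_on {0..1} (\<lambda>s. G (1 - s) 1)" "continuous_on {0..1} (\<lambda>s. G (1 - s) 0)"
      by (rule cG; auto intro!: continuous_intros)+
  qed (use top G hs in auto)
  then have "G 0 1 = G 0 0" by simp
  then show ?thesis using bottom G00 by (simp add: pathstart_def pathfinish_def)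
qed

text \<open>The deck transformation taking \<open>a\<close> to \<open>b\<close> takes \<open>z\<close> to the unique \<open>w\<close> in this relation.\<close>

definition joint_paths :: "'c \<Rightarrow> 'c \<Rightarrow> 'c \<Rightarrow> 'c \<Rightarrow> bool" where
  "joint_paths a b z w \<longleftrightarrow> (\<exists>c d. path c \<and> path_image c \<subseteq> C \<and> pathstart c = a \<and> pathfinish c = z \<and>
     path d \<and> path_image d \<subseteq> C \<and> pathstart d = b \<and> pathfinish d = w \<and> (\<forall>t\<in>{0..1}. p (c t) = p (d t)))"

lemma joint_paths_sym: "joint_paths a b z w \<Longrightarrow> joint_paths b a w z"
  unfolding joint_paths_def by metis

lemma joint_paths_rev: "joint_paths a b z w \<Longrightarrow> joint_paths z w a b"
  unfolding joint_paths_def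
proof (elim exE conjE, intro exI conjI)
  fix c d :: "real \<Rightarrow> 'c" assume "\<forall>t\<in>{0..1}. p (c t) = p (d t)"
  then show "\<forall>t\<in>{0..1}. p (reversepath c t) = p (reversepath d t)"
    by (simp add: reversepath_def)
qed auto

lemma joint_paths_trans:
  assumes "joint_paths a b z w" "joint_paths z w z' w'"
  shows "joint_paths a b z' w'"
proof -
  obtain c d where 1: "path c" "path_image c \<subseteq> C" "pathstart c = a" "pathfinish c = z"
    "path d" "path_image d \<subseteq> C" "pathstart d = b" "pathfinish d = w" "\<And>t. t \<in> {0..1} \<Longrightarrow> p (c t) = p (d t)"
    using assms(1) unfolding joint_paths_def by auto
  obtain c' d' where 2: "path c'" "path_image c' \<subseteq> C" "pathstart c' = z" "pathfinish c' = z'"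
    "path d'" "path_image d' \<subseteq> C" "pathstart d' = w" "pathfinish d' = w'" "\<And>t. t \<in> {0..1} \<Longrightarrow> p (c' t) = p (d' t)"
    using assms(2) unfolding joint_paths_def by auto
  have "p ((c +++ c') t) = p ((d +++ d') t)" if "t \<in> {0..1}" for t
    using that 1(9) 2(9) by (auto simp: joinpaths_def)
  moreover have "path (c +++ c')" "path (d +++ d')" using 1 2 by simp_all
  moreover have "path_image (c +++ c') \<subseteq> C" "path_image (d +++ d') \<subseteq> C"
    by (intro subset_path_image_join 1 2)+
  moreover have "pathstart (c +++ c') = a" "pathfinish (c +++ c') = z'"
    "pathstart (d +++ d') = b" "pathfinish (d +++ d') = w'" using 1 2 by simp_all
  ultimately show ?thesis unfolding joint_paths_def by blast
qed

lemma joint_paths_points: "joint_paths a b z w \<Longrightarrow> z \<in> C \<and> w \<in> C \<and> p z = p w"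
  unfolding joint_paths_def using pathfinish_in_path_image
  by (metis atLeastAtMost_iff order_refl pathfinish_def subsetD zero_le_one)

lemma joint_paths_refl: "a \<in> C \<Longrightarrow> b \<in> C \<Longrightarrow> p a = p b \<Longrightarrow> joint_paths a b a b"
  unfolding joint_paths_def
  by (intro exI[of _ "\<lambda>_. a"] exI[of _ "\<lambda>_. b"])
    (auto simp: path_def path_image_def pathstart_def pathfinish_def)

lemma joint_paths_exists:
  assumes "a \<in> C" "b \<in> C" "p a = p b" "z \<in> C"
  shows "\<exists>w. joint_paths a b z w"
proof -
  obtain c where c: "path c" "path_image c \<subseteq> C" "pathstart c = a" "pathfinish c = z"
    using path_connected_cover assms unfolding path_connected_def by metis
  have "continuous_on (path_image c) p"
    using p_cont c(2) by (rule continuous_on_subset)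
  then have "path (p \<circ> c)" using c(1) by (intro path_continuous_image)
  moreover have "path_image (p \<circ> c) \<subseteq> S" using c(2) p_image by (auto simp: path_image_def)
  moreover have "p b = pathstart (p \<circ> c)" using assms c by (simp add: pathstart_def)
  ultimately obtain d where "path d" "path_image d \<subseteq> C" "pathstart d = b" "\<And>t. t \<in> {0..1} \<Longrightarrow> p (d t) = (p \<circ> c) t"
    using lift_path[of "p \<circ> c" b] assms(2) by metis
  then show ?thesis
    unfolding joint_paths_def using c by (intro exI[of _ "pathfinish d"] exI[of _ c] exI[of _ d]) auto
qed

text \<open>Going back along the first pair of paths and out along the second gives a loop at
  \<open>z\<close> and, over the same image, a path from \<open>w\<close> to \<open>w'\<close>. That
  path must close up by \<open>loop_over_image_of_loop\<close>.\<close>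

lemma joint_paths_unique:
  assumes "joint_paths a b z w" "joint_paths a b z w'"
  shows "w' = w"
proof -
  have "joint_paths z w z w'"
    using joint_paths_trans[OF joint_paths_rev[OF assms(1)] assms(2)] .
  then obtain c d where 1: "path c" "path_image c \<subseteq> C" "pathstart c = z" "pathfinish c = z"
    "path d" "path_image d \<subseteq> C" "pathstart d = w" "pathfinish d = w'" "\<And>t. t \<in> {0..1} \<Longrightarrow> p (c t) = p (d t)"
    unfolding joint_paths_def by auto
  then show ?thesis
    using loop_over_image_of_loop[of c d] by auto
qed

text \<open>Near \<open>z\<close> the continuation is \<open>r \<circ> p\<close>: down to the base
  and up again on the sheet of \<open>w\<close>. A path from \<open>p z\<close> to
  \<open>p y\<close> inside the path connected \<open>N\<close>, lifted by both sheet inverses,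
  prolongs the given pair of paths.\<close>

lemma joint_paths_local:
  assumes "joint_paths a b z w"
  obtains A q where "openin (top_of_set C) A" "z \<in> A" "continuous_on A q" "\<And>y. y \<in> A \<Longrightarrow> joint_paths a b y (q y)"
proof -
  have zw: "z \<in> C" "w \<in> C" "p z = p w" using joint_paths_points[OF assms] by auto
  from sheets[OF this] obtain U A B q r where U: "openin (top_of_set S) U" "p z \<in> U"
    and A: "openin (top_of_set C) A" "openin (top_of_set C) B" "z \<in> A" "w \<in> B"
    and q: "homeomorphism A U p q" and r: "homeomorphism B U p r"
    by (metis (no_types, lifting))
  obtain N where N: "openin (top_of_set S) N" "p z \<in> N" "N \<subseteq> U" "path_connected N"
    using lpc U by blast
  have AC: "A \<subseteq> C" "B \<subseteq> C" using openin_imp_subset[OF A(1)] openin_imp_subset[OF A(2)] by blast+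
  have "openin (top_of_set C) (A \<inter> (C \<inter> p -` N))"
  proof (rule openin_Int[OF A(1)])
    show "openin (top_of_set C) (C \<inter> p -` N)"
      using continuous_openin_preimage[OF p_cont _ N(1)] p_image by auto
  qed
  moreover have "continuous_on (A \<inter> (C \<inter> p -` N)) (r \<circ> p)"
    by (rule continuous_on_compose) (use r N p_cont in \<open>auto simp: homeomorphism_def intro: continuous_on_subset\<close>)
  moreover have "joint_paths a b y ((r \<circ> p) y)" if y: "y \<in> A \<inter> (C \<inter> p -` N)" for y
  proof -
    obtain c where c: "path c" "path_image c \<subseteq> N" "pathstart c = p z" "pathfinish c = p y"
      using N y unfolding path_connected_def by (metis IntD2 vimageD)
    have cU: "path_image c \<subseteq> U" using c N by auto
    have 1: "path (q \<circ> c)" "path (r \<circ> c)"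
      using c(1) cU q r by (auto intro!: path_continuous_image simp: homeomorphism_def intro: continuous_on_subset)
    have 2: "path_image (q \<circ> c) \<subseteq> C" "path_image (r \<circ> c) \<subseteq> C"
      using cU homeomorphism_image2[OF q] homeomorphism_image2[OF r] AC by (auto simp: path_image_def)
    have 3: "pathstart (q \<circ> c) = z" "pathstart (r \<circ> c) = w" "pathfinish (q \<circ> c) = y" "pathfinish (r \<circ> c) = r (p y)"
      using c(3,4) y zw homeomorphism_apply1[OF q A(3)] homeomorphism_apply1[OF r A(4)] homeomorphism_apply1[OF q, of y]
      by (simp_all add: pathstart_compose pathfinish_compose)
    have "p ((q \<circ> c) t) = p ((r \<circ> c) t)" if "t \<in> {0..1}" for t
    proof -
      have "c t \<in> U" using that cU by (auto simp: path_image_def)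
      then show ?thesis using homeomorphism_apply2[OF q] homeomorphism_apply2[OF r] by simp
    qed
    then have "joint_paths z w y (r (p y))"
      unfolding joint_paths_def using 1 2 3 by blast
    then show ?thesis using joint_paths_trans[OF assms] by simp
  qed
  ultimately show ?thesis
    using that[of "A \<inter> (C \<inter> p -` N)" "r \<circ> p"] A zw N by auto
qed

text \<open>By uniqueness, \<open>g\<close> coincides near each point with the continuous local
  continuation.\<close>

lemma continuous_joint_paths:
  assumes g: "\<And>z. z \<in> C \<Longrightarrow> joint_paths a b z (g z)"
  shows "continuous_on C g"
  unfolding continuous_openin_preimage_eq
proof (intro allI impI)
  fix V :: "'c set" assume V: "open V"
  show "openin (top_of_set C) (C \<inter> g -` V)"
  proof (subst openin_subopen, intro ballI)
    fix z assume z: "z \<in> C \<inter> g -` V"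
    then obtain A q where A: "openin (top_of_set C) A" "z \<in> A" "continuous_on A q"
      "\<And>y. y \<in> A \<Longrightarrow> joint_paths a b y (q y)"
      using joint_paths_local[OF g[of z]] by blast
    have AC: "A \<subseteq> C" by (rule openin_imp_subset[OF A(1)])
    have gq: "g y = q y" if "y \<in> A" for y
      using joint_paths_unique[OF A(4)[OF that] g] AC that by blast
    have "openin (top_of_set A) (A \<inter> q -` V)"
      by (rule continuous_openin_preimage_gen[OF A(3) V])
    then have "openin (top_of_set C) (A \<inter> q -` V)"
      using A(1) openin_trans by blast
    moreover have "z \<in> A \<inter> q -` V" "A \<inter> q -` V \<subseteq> C \<inter> g -` V"
      using z A(2) gq AC by auto
    ultimately show "\<exists>W. openin (top_of_set C) W \<and> z \<in> W \<and> W \<subseteq> C \<inter> g -` V" by blast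
  qed
qed

text \<open>The inverse of the transport from \<open>a\<close> to \<open>b\<close> is the transport
  from \<open>b\<close> to \<open>a\<close>, since \<open>joint_paths\<close> is symmetric under
  exchange of the two paths and determines each end from the other.\<close>

theorem deck_transformation_exists:
  assumes ab: "a \<in> C" "b \<in> C" "p a = p b"
  obtains g where "deck_transformation C p g" "g a = b"
proof -
  obtain g where g: "\<And>z. z \<in> C \<Longrightarrow> joint_paths a b z (g z)"
    using joint_paths_exists[OF ab] by metis
  obtain h where h: "\<And>z. z \<in> C \<Longrightarrow> joint_paths b a z (h z)"
    using joint_paths_exists[OF ab(2,1)] ab(3) by metis
  have gC: "g z \<in> C" "p (g z) = p z" "h z \<in> C" if "z \<in> C" for z
    using joint_paths_points[OF g[OF that]] joint_paths_points[OF h[OF that]] by auto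
  have "homeomorphism C C g h"
  proof (rule homeomorphismI)
    show "continuous_on C g" "continuous_on C h"
      using continuous_joint_paths g h by blast+
    show "h (g z) = z" if "z \<in> C" for z
      using joint_paths_unique[OF joint_paths_sym[OF g[OF that]] h[OF gC(1)[OF that]]] by simp
    show "g (h z) = z" if "z \<in> C" for z
      using joint_paths_unique[OF joint_paths_sym[OF h[OF that]] g[OF gC(3)[OF that]]] by simp
  qed (use gC in auto)
  then have "deck_transformation C p g"
    using gC unfolding deck_transformation_def by blast
  moreover have "g a = b"
    using joint_paths_unique[OF joint_paths_refl[OF ab] g[OF ab(1)]] .
  ultimately show ?thesis by (rule that)
qed

end

section \<open>Cube complexes: their defining clauses as rules, and local path connectedness\<close>

lemma
  assumes "cube_complex X"
  shows cube_complex_charmap: "\<sigma> \<in> charmaps X n \<Longrightarrow> \<sigma> \<in> extensional (cube n) \<and> continuous_on (cube n) \<sigma> \<and>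
      \<sigma> ` cube n \<subseteq> points X \<and> inj_on \<sigma> (open_cube n)"
    and cube_complex_symmetry: "\<sigma> \<in> charmaps X n \<Longrightarrow> s \<in> cube_symmetries n \<Longrightarrow>
      restrict (\<sigma> \<circ> s) (cube n) \<in> charmaps X n"
    and cube_complex_face: "\<sigma> \<in> charmaps X (Suc n) \<Longrightarrow> j \<le> n \<Longrightarrow> e \<in> {0, 1} \<Longrightarrow>
      restrict (\<sigma> \<circ> face_incl j e) (cube n) \<in> charmaps X n"
    and cube_complex_same_cell: "\<sigma> \<in> charmaps X m \<Longrightarrow> \<tau> \<in> charmaps X n \<Longrightarrow>
      \<sigma> ` open_cube m \<inter> \<tau> ` open_cube n \<noteq> {} \<Longrightarrow>
      \<exists>s\<in>cube_symmetries n. \<tau> = restrict (\<sigma> \<circ> s) (cube n)"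
    and cube_complex_weak_topology: "U \<subseteq> points X \<Longrightarrow>
      (\<And>n \<sigma>. \<sigma> \<in> charmaps X n \<Longrightarrow> openin (top_of_set (cube n)) (cube n \<inter> \<sigma> -` U)) \<Longrightarrow>
      openin (top_of_set (points X)) U"
proof -
  note X = assms[unfolded cube_complex_def]
  show "\<sigma> \<in> charmaps X n \<Longrightarrow> \<sigma> \<in> extensional (cube n) \<and> continuous_on (cube n) \<sigma> \<and>
      \<sigma> ` cube n \<subseteq> points X \<and> inj_on \<sigma> (open_cube n)"
    by (rule X[THEN conjunct2, THEN conjunct1, rule_format])
  show "\<sigma> \<in> charmaps X n \<Longrightarrow> s \<in> cube_symmetries n \<Longrightarrow> restrict (\<sigma> \<circ> s) (cube n) \<in> charmaps X n"
    by (rule X[THEN conjunct2, THEN conjunct2, THEN conjunct1, rule_format])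
  show "\<sigma> \<in> charmaps X (Suc n) \<Longrightarrow> j \<le> n \<Longrightarrow> e \<in> {0, 1} \<Longrightarrow>
      restrict (\<sigma> \<circ> face_incl j e) (cube n) \<in> charmaps X n"
    by (rule X[THEN conjunct2, THEN conjunct2, THEN conjunct2, THEN conjunct1, rule_format])
  show "\<sigma> \<in> charmaps X m \<Longrightarrow> \<tau> \<in> charmaps X n \<Longrightarrow> \<sigma> ` open_cube m \<inter> \<tau> ` open_cube n \<noteq> {} \<Longrightarrow>
      \<exists>s\<in>cube_symmetries n. \<tau> = restrict (\<sigma> \<circ> s) (cube n)"
    by (rule X[THEN conjunct2, THEN conjunct2, THEN conjunct2, THEN conjunct2, THEN conjunct2,
        THEN conjunct1, rule_format, THEN conjunct2])
  show "U \<subseteq> points X \<Longrightarrow>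
      (\<And>n \<sigma>. \<sigma> \<in> charmaps X n \<Longrightarrow> openin (top_of_set (cube n)) (cube n \<inter> \<sigma> -` U)) \<Longrightarrow>
      openin (top_of_set (points X)) U"
    by (rule X[THEN conjunct2, THEN conjunct2, THEN conjunct2, THEN conjunct2, THEN conjunct2,
        THEN conjunct2, rule_format])
qed

text \<open>By the weak topology it suffices to see that path components of open sets have open preimages
  in the cubes, which are locally path connected.\<close>

lemma cube_complex_locally_path_connected:
  assumes X: "cube_complex X" and U: "openin (top_of_set (points X)) U" and x: "x \<in> U"
  shows "\<exists>N. openin (top_of_set (points X)) N \<and> x \<in> N \<and> N \<subseteq> U \<and> path_connected N"
proof -
  let ?N = "path_component_set U x"
  have NU: "?N \<subseteq> U" by (rule path_component_subset)
  have UX: "U \<subseteq> points X" by (rule openin_imp_subset[OF U])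
  have "openin (top_of_set (cube n)) (cube n \<inter> \<sigma> -` ?N)" if \<sigma>: "\<sigma> \<in> charmaps X n" for n \<sigma>
  proof (subst openin_subopen, intro ballI)
    fix y assume y: "y \<in> cube n \<inter> \<sigma> -` ?N"
    have c\<sigma>: "continuous_on (cube n) \<sigma>" "\<sigma> ` cube n \<subseteq> points X"
      using cube_complex_charmap[OF X \<sigma>] by simp_all
    have "openin (top_of_set (cube n)) (cube n \<inter> \<sigma> -` U)"
      using c\<sigma> U by (auto intro: continuous_openin_preimage)
    moreover have "y \<in> cube n \<inter> \<sigma> -` U" using y NU by auto
    ultimately obtain d where d: "d > 0"
      "\<And>f. f \<in> cube n \<Longrightarrow> (\<And>i. i < n \<Longrightarrow> \<bar>f i - y i\<bar> \<le> d) \<Longrightarrow> f \<in> cube n \<inter> \<sigma> -` U"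
      using product_neighbourhood_contains_box by metis
    \<comment> \<open>Two boxes around \<open>y\<close>: the closed one is path connected and mapped
      into \<open>U\<close>, so its image stays in one path component; the open one inside it is the
      required neighbourhood.\<close>
    define B where "B = {f \<in> cube n. \<forall>i<n. y i - d \<le> f i \<and> f i \<le> y i + d}"
    define W where "W = cube n \<inter> (\<Inter>i\<in>{..<n}. {f. y i - d < f i} \<inter> {f. f i < y i + d})"
    have WB: "W \<subseteq> B" by (auto simp: W_def B_def less_imp_le)
    have "path_connected B" unfolding B_def by (rule path_connected_box)
    moreover have BU: "B \<subseteq> cube n \<inter> \<sigma> -` U"
    proof
      fix f assume "f \<in> B"
      then have "f \<in> cube n" "\<And>i. i < n \<Longrightarrow> \<bar>f i - y i\<bar> \<le> d"
        by (auto simp: B_def abs_le_iff)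
      then show "f \<in> cube n \<inter> \<sigma> -` U" by (rule d(2))
    qed
    ultimately have "path_connected (\<sigma> ` B)"
      by (intro path_connected_continuous_image) (auto intro: continuous_on_subset[OF c\<sigma>(1)])
    moreover have yW: "y \<in> W" using y d(1) by (auto simp: W_def)
    moreover have "\<sigma> ` B \<subseteq> U" using BU by auto
    ultimately have "\<sigma> ` B \<subseteq> path_component_set U (\<sigma> y)"
      using path_component_maximal[of "\<sigma> y" "\<sigma> ` B" U] WB by auto
    also have "\<dots> = ?N" using y by (metis IntD2 mem_Collect_eq path_component_eq vimageD)
    finally have "W \<subseteq> cube n \<inter> \<sigma> -` ?N" using WB unfolding W_def by auto
    moreover have "openin (top_of_set (cube n)) W"
      unfolding W_def
      by (intro openin_open_Int open_INT ballI open_Int)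
        (auto intro!: open_Collect_less continuous_on_product_coordinates continuous_on_const)
    ultimately show "\<exists>W. openin (top_of_set (cube n)) W \<and> y \<in> W \<and> W \<subseteq> cube n \<inter> \<sigma> -` ?N"
      using yW by blast
  qed
  then have "openin (top_of_set (points X)) ?N"
    using NU UX by (intro cube_complex_weak_topology[OF X]) auto
  moreover have "x \<in> ?N" using x by (simp add: path_component_refl)
  ultimately show ?thesis
    using NU path_connected_path_component by blast
qed

section \<open>Cubes in a product of trees\<close>

text \<open>Trades the lambda term of the definition for pointwise conditions. The
  \<open>the_inv_into\<close> disappears because moving coordinates are addressed as
  \<open>c j\<close> with \<open>j < n\<close>.\<close>

lemma product_charmap_iff:
  "product_charmap k T n c \<sigma> \<longleftrightarrow>
     c ` {..<n} \<subseteq> {1..k} \<and> inj_on c {..<n} \<and> \<sigma> \<in> extensional (cube n) \<and>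
     (\<exists>e. (\<forall>j<n. e (c j) \<in> charmaps (T (c j)) 1) \<and>
          (\<forall>i\<in>{1..k} - c ` {..<n}. e i \<in> charmaps (T i) 0) \<and>
          (\<forall>f\<in>cube n. \<sigma> f \<in> extensional {1..k} \<and>
             (\<forall>j<n. \<sigma> f (c j) = e (c j) ((\<lambda>_. 0)(0 := f j))) \<and>
             (\<forall>i\<in>{1..k} - c ` {..<n}. \<sigma> f i = e i (\<lambda>_. 0))))"
proof -
  have "\<sigma> = (\<lambda>f\<in>cube n. \<lambda>i\<in>{1..k}.
          if i \<in> c ` {..<n} then e i ((\<lambda>_. 0)(0 := f (the_inv_into {..<n} c i))) else e i (\<lambda>_. 0)) \<longleftrightarrow>
        \<sigma> \<in> extensional (cube n) \<and> (\<forall>f\<in>cube n. \<sigma> f \<in> extensional {1..k} \<and>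
             (\<forall>j<n. \<sigma> f (c j) = e (c j) ((\<lambda>_. 0)(0 := f j))) \<and>
             (\<forall>i\<in>{1..k} - c ` {..<n}. \<sigma> f i = e i (\<lambda>_. 0)))" (is "\<sigma> = ?R \<longleftrightarrow> ?rhs")
    if c: "c ` {..<n} \<subseteq> {1..k}" "inj_on c {..<n}" for e
  proof
    have inv: "the_inv_into {..<n} c (c j) = j" if "j < n" for j
      using the_inv_into_f_f[OF c(2)] that by simp
    have R: "?R f (c j) = e (c j) ((\<lambda>_. 0)(0 := f j))" if "f \<in> cube n" "j < n" for f j
      using that c(1) inv[OF that(2)] by (simp add: image_subset_iff)
    show "?rhs" if "\<sigma> = ?R"
      unfolding that using R by (simp del: restrict_apply add: restrict_apply')
    show "\<sigma> = ?R" if rhs: ?rhs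
    proof (intro extensionalityI[of \<sigma> "cube n" ?R] extensionalityI[of "\<sigma> f" "{1..k}" "?R f" for f])
      fix f i assume f: "f \<in> cube n" and i: "i \<in> {1..k}"
      show "\<sigma> f i = ?R f i"
      proof (cases "i \<in> c ` {..<n}")
        case True
        then obtain j where "j < n" "i = c j" by auto
        then show ?thesis using R[OF f] rhs f by simp
      next
        case False
        then show ?thesis using rhs f i by simp
      qed
    qed (use rhs in auto)
  qed
  note eq = this
  show ?thesis
  proof (cases "c ` {..<n} \<subseteq> {1..k} \<and> inj_on c {..<n}")
    case True
    show ?thesis
      unfolding product_charmap_def eq[OF conjunct1[OF True] conjunct2[OF True]]
      by (rule iffI; elim conjE exE; intro conjI exI; assumption)
  qed (auto simp: product_charmap_def)
qed

lemma product_charmapE: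
  assumes "product_charmap k T n c \<sigma>"
  obtains e where "\<And>j. j < n \<Longrightarrow> c j \<in> {1..k}" "inj_on c {..<n}"
    "\<And>j. j < n \<Longrightarrow> e (c j) \<in> charmaps (T (c j)) 1"
    "\<And>i. i \<in> {1..k} \<Longrightarrow> i \<notin> c ` {..<n} \<Longrightarrow> e i \<in> charmaps (T i) 0"
    "\<And>f. f \<in> cube n \<Longrightarrow> \<sigma> f \<in> extensional {1..k}"
    "\<And>f j. f \<in> cube n \<Longrightarrow> j < n \<Longrightarrow> \<sigma> f (c j) = e (c j) ((\<lambda>_. 0)(0 := f j))"
    "\<And>f i. f \<in> cube n \<Longrightarrow> i \<in> {1..k} \<Longrightarrow> i \<notin> c ` {..<n} \<Longrightarrow> \<sigma> f i = e i (\<lambda>_. 0)"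
proof -
  from assms[unfolded product_charmap_iff] obtain e where
    e: "c ` {..<n} \<subseteq> {1..k}" "inj_on c {..<n}" "\<forall>j<n. e (c j) \<in> charmaps (T (c j)) 1"
      "\<forall>i\<in>{1..k} - c ` {..<n}. e i \<in> charmaps (T i) 0"
    and \<sigma>: "\<forall>f\<in>cube n. \<sigma> f \<in> extensional {1..k} \<and>
             (\<forall>j<n. \<sigma> f (c j) = e (c j) ((\<lambda>_. 0)(0 := f j))) \<and>
             (\<forall>i\<in>{1..k} - c ` {..<n}. \<sigma> f i = e i (\<lambda>_. 0))"
    by (elim conjE exE)
  show ?thesis
    by (rule that[of e]) (use e \<sigma> in \<open>simp_all add: image_subset_iff del: One_nat_def\<close>)
qed

lemma product_charmap_cong:
  "(\<And>j. j < n \<Longrightarrow> c j = c' j) \<Longrightarrow> product_charmap k T n c \<sigma> \<longleftrightarrow> product_charmap k T n c' \<sigma>"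
proof -
  assume c: "\<And>j. j < n \<Longrightarrow> c j = c' j"
  then have "c ` {..<n} = c' ` {..<n}" "inj_on c {..<n} = inj_on c' {..<n}"
    by (auto intro!: image_cong inj_on_cong)
  then show ?thesis
    unfolding product_charmap_iff using c by simp
qed

text \<open>The rigidity on which all comparisons of directions and faces rest: component
  \<open>l\<close> reads at most the one cube coordinate \<open>j\<close> with
  \<open>c j = l\<close>. An index outside \<open>{1..k}\<close> is harmless, as extensionality
  makes both sides \<open>undefined\<close>.\<close>

lemma product_charmap_local:
  assumes \<sigma>: "product_charmap k T n c \<sigma>" and fg: "f \<in> cube n" "g \<in> cube n"
    and eq: "\<And>j. j < n \<Longrightarrow> c j = l \<Longrightarrow> f j = g j"
  shows "\<sigma> f l = \<sigma> g l"
proof -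
  obtain e where "\<And>j. j < n \<Longrightarrow> e (c j) \<in> charmaps (T (c j)) 1"
    and ext: "\<And>f. f \<in> cube n \<Longrightarrow> \<sigma> f \<in> extensional {1..k}"
    and s1: "\<And>f j. f \<in> cube n \<Longrightarrow> j < n \<Longrightarrow> \<sigma> f (c j) = e (c j) ((\<lambda>_. 0)(0 := f j))"
    and s0: "\<And>f i. f \<in> cube n \<Longrightarrow> i \<in> {1..k} \<Longrightarrow> i \<notin> c ` {..<n} \<Longrightarrow> \<sigma> f i = e i (\<lambda>_. 0)"
    by (rule product_charmapE[OF \<sigma>]) (rule that)
  show ?thesis
  proof (cases "l \<in> c ` {..<n}")
    case True
    then obtain j where j: "j < n" "l = c j" by auto
    then show ?thesis using s1[OF fg(1)] s1[OF fg(2)] eq[of j] by simp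
  next
    case False
    then show ?thesis
      using s0[OF fg(1)] s0[OF fg(2)] extensional_arb[OF ext[OF fg(1)]] extensional_arb[OF ext[OF fg(2)]]
      by (cases "l \<in> {1..k}") simp_all
  qed
qed

text \<open>Counterpart of \<open>product_charmap_local\<close>: the component \<open>c j\<close>
  really moves with coordinate \<open>j\<close>, because the characteristic map of an edge is
  injective on the open cube.\<close>

lemma product_charmap_varies:
  assumes T: "\<And>i. i \<in> {1..k} \<Longrightarrow> cube_complex (T i)"
    and \<sigma>: "product_charmap k T n c \<sigma>" and f: "f \<in> cube n" and j: "j < n"
  obtains s t where "f(j := s) \<in> cube n" "f(j := t) \<in> cube n" "\<sigma> (f(j := s)) (c j) \<noteq> \<sigma> (f(j := t)) (c j)"
proof -
  obtain e where c: "\<And>j. j < n \<Longrightarrow> c j \<in> {1..k}"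
    and e: "\<And>j. j < n \<Longrightarrow> e (c j) \<in> charmaps (T (c j)) 1"
      "\<And>f j. f \<in> cube n \<Longrightarrow> j < n \<Longrightarrow> \<sigma> f (c j) = e (c j) ((\<lambda>_. 0)(0 := f j))"
    by (rule product_charmapE[OF \<sigma>]) (rule that)
  have "cube_complex (T (c j))" using T c j by blast
  then have inj: "inj_on (e (c j)) (open_cube 1)"
    using cube_complex_charmap e(1)[OF j] by blast
  have m: "f(j := s) \<in> cube n" if "0 \<le> s" "s \<le> 1" for s
    using f that j by (auto simp: cube_def)
  let ?u = "\<lambda>t. (\<lambda>_. 0 :: real)((0::nat) := t)"
  \<comment> \<open>Any two interior points would do. Endpoints would not, since a characteristic
    map need only be injective on the open cube.\<close>
  have "?u (1/4) \<in> open_cube 1" "?u (1/2) \<in> open_cube 1"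
    by (auto simp: open_cube_def)
  moreover have "?u (1/4) \<noteq> ?u (1/2)"
  proof
    assume "?u (1/4) = ?u (1/2)"
    then have "?u (1/4) 0 = ?u (1/2) 0" by (rule fun_cong)
    then show False by simp
  qed
  ultimately have ne: "e (c j) (?u (1/4)) \<noteq> e (c j) (?u (1/2))"
    using inj_onD[OF inj] by blast
  have "\<sigma> (f(j := s)) (c j) = e (c j) (?u s)" if "0 \<le> s" "s \<le> 1" for s
    using e(2)[OF m[OF that] j] by simp
  from this[of "1/4"] this[of "1/2"] ne
  have "\<sigma> (f(j := 1/4)) (c j) \<noteq> \<sigma> (f(j := 1/2)) (c j)" by simp
  then show ?thesis
    using that[OF m m, of "1/4" "1/2"] by simp
qed

lemma product_edges_local:
  "x \<in> product_edges k T i \<Longrightarrow> f \<in> cube 1 \<Longrightarrow> g \<in> cube 1 \<Longrightarrow> l \<noteq> i \<Longrightarrow> x f l = x g l"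
  unfolding product_edges_def mem_Collect_eq by (rule product_charmap_local) auto

lemma product_charmap_1_iff:
  "product_charmap k T 1 c x \<longleftrightarrow> x \<in> product_edges k T (c 0)"
  unfolding product_edges_def mem_Collect_eq by (rule product_charmap_cong) simp

text \<open>The corner opposite the origin, at which a path along the first \<open>n\<close>
  coordinates ends and the next edge is attached.\<close>

definition far_corner :: "nat \<Rightarrow> nat \<Rightarrow> real" where
  "far_corner n = (\<lambda>i. if i < n then 1 else 0)"

lemma far_corner_in_cube: "far_corner n \<in> cube n"
  by (simp add: cube_def far_corner_def)

lemma cube_Suc_subset: "f \<in> cube n \<Longrightarrow> f \<in> cube (Suc n)" and cube_Suc_upd: "f \<in> cube (Suc n) \<Longrightarrow> f(n := 0) \<in> cube n"
  by (auto simp: cube_def less_Suc_eq)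

lemma product_charmap_extend:
  assumes \<tau>: "product_charmap k T n c \<tau>" and y: "y \<in> product_edges k T i" and i: "i \<notin> c ` {..<n}"
    and joint: "y (\<lambda>_. 0) = \<tau> (far_corner n)"
  obtains \<tau>' where "product_charmap k T (Suc n) (c(n := i)) \<tau>'"
    "\<And>f. f \<in> cube n \<Longrightarrow> \<tau>' f = \<tau> f"
    "\<And>t. 0 \<le> t \<Longrightarrow> t \<le> 1 \<Longrightarrow> \<tau>' ((far_corner n)(n := t)) = y ((\<lambda>_. 0)(0 := t))"
proof -
  obtain e where c: "\<And>j. j < n \<Longrightarrow> c j \<in> {1..k}" "inj_on c {..<n}"
    and e1: "\<And>j. j < n \<Longrightarrow> e (c j) \<in> charmaps (T (c j)) 1"
    and e0: "\<And>l. l \<in> {1..k} \<Longrightarrow> l \<notin> c ` {..<n} \<Longrightarrow> e l \<in> charmaps (T l) 0"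
    and ext: "\<And>f. f \<in> cube n \<Longrightarrow> \<tau> f \<in> extensional {1..k}"
    and \<tau>1: "\<And>f j. f \<in> cube n \<Longrightarrow> j < n \<Longrightarrow> \<tau> f (c j) = e (c j) ((\<lambda>_. 0)(0 := f j))"
    and \<tau>0: "\<And>f l. f \<in> cube n \<Longrightarrow> l \<in> {1..k} \<Longrightarrow> l \<notin> c ` {..<n} \<Longrightarrow> \<tau> f l = e l (\<lambda>_. 0)"
    by (rule product_charmapE[OF \<tau>]) (rule that)
  from y[unfolded product_edges_def mem_Collect_eq]
  obtain d where "\<And>j::nat. j < 1 \<Longrightarrow> i \<in> {1..k}" "\<And>j::nat. j < 1 \<Longrightarrow> d i \<in> charmaps (T i) 1"
    "\<And>f j. f \<in> cube 1 \<Longrightarrow> j < 1 \<Longrightarrow> y f i = d i ((\<lambda>_. 0)(0 := f j))"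
    by (rule product_charmapE) (rule that)
  from this(1)[of 0] this(2)[of 0] this(3)[of _ 0]
  have ik: "i \<in> {1..k}" and d: "d i \<in> charmaps (T i) 1"
    and yi: "\<And>f. f \<in> cube 1 \<Longrightarrow> y f i = d i ((\<lambda>_. 0)(0 := f 0))"
    by simp_all
  define e' where "e' = e(i := d i)"
  \<comment> \<open>\<open>f(n := 0)\<close> forgets the new coordinate, which steers component
    \<open>i\<close> alone.\<close>
  define \<tau>' where "\<tau>' = (\<lambda>f\<in>cube (Suc n). (\<tau> (f(n := 0)))(i := d i ((\<lambda>_. 0)(0 := f n))))"
  let ?c = "c(n := i)"
  have img: "?c ` {..<Suc n} = insert i (c ` {..<n})"
    using i by (auto simp: lessThan_Suc)
  have "product_charmap k T (Suc n) ?c \<tau>'"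
    unfolding product_charmap_iff
  proof (intro conjI exI[of _ e'])
    show "?c ` {..<Suc n} \<subseteq> {1..k}" unfolding img using ik c by auto
    show "inj_on ?c {..<Suc n}"
      using c(2) i by (auto simp: inj_on_def less_Suc_eq)
    show "\<tau>' \<in> extensional (cube (Suc n))" unfolding \<tau>'_def by simp
    show "\<forall>j<Suc n. e' (?c j) \<in> charmaps (T (?c j)) 1"
      using e1 i d unfolding e'_def by (auto simp: less_Suc_eq simp del: One_nat_def)
    show "\<forall>l\<in>{1..k} - ?c ` {..<Suc n}. e' l \<in> charmaps (T l) 0"
      unfolding img e'_def using e0 by auto
    show "\<forall>f\<in>cube (Suc n). \<tau>' f \<in> extensional {1..k} \<and>
        (\<forall>j<Suc n. \<tau>' f (?c j) = e' (?c j) ((\<lambda>_. 0)(0 := f j))) \<and>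
        (\<forall>l\<in>{1..k} - ?c ` {..<Suc n}. \<tau>' f l = e' l (\<lambda>_. 0))"
    proof (intro ballI conjI allI impI)
      fix f assume f: "f \<in> cube (Suc n)"
      note f' = cube_Suc_upd[OF f]
      show "\<tau>' f \<in> extensional {1..k}"
        using ext[OF f'] f ik unfolding \<tau>'_def by (auto simp: extensional_def)
      show "\<tau>' f (?c j) = e' (?c j) ((\<lambda>_. 0)(0 := f j))" if "j < Suc n" for j
        using \<tau>1[OF f', of j] that f i unfolding \<tau>'_def e'_def by (auto simp: less_Suc_eq)
      show "\<tau>' f l = e' l (\<lambda>_. 0)" if "l \<in> {1..k} - ?c ` {..<Suc n}" for l
        using that \<tau>0[OF f', of l] f unfolding img \<tau>'_def e'_def by auto
    qed
  qed
  moreover have "\<tau>' f = \<tau> f" if f: "f \<in> cube n" for f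
  proof
    fix l
    have fn: "f n = 0" "f(n := 0) = f" using f by (auto simp: cube_def)
    have "y (\<lambda>_. 0) i = d i ((\<lambda>_. 0)(0 := 0))"
      using yi[of "\<lambda>_. 0"] by (simp add: cube_def)
    moreover have "\<tau> (far_corner n) i = \<tau> f i"
      by (rule product_charmap_local[OF \<tau> far_corner_in_cube f]) (use i in auto)
    ultimately show "\<tau>' f l = \<tau> f l"
      using fn cube_Suc_subset[OF f] joint unfolding \<tau>'_def by simp
  qed
  moreover have "\<tau>' ((far_corner n)(n := t)) = y ((\<lambda>_. 0)(0 := t))" if t: "0 \<le> t" "t \<le> 1" for t
  proof
    fix l
    have m: "(far_corner n)(n := t) \<in> cube (Suc n)" "(far_corner n)(n := t, n := 0) = far_corner n"
      using t by (auto simp: cube_def far_corner_def)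
    have "y ((\<lambda>_. 0)(0 := t)) l = y (\<lambda>_. 0) l" if "l \<noteq> i"
      by (rule product_edges_local[OF y segment_in_cube(1)[OF t] _ that]) (simp add: cube_def)
    then show "\<tau>' ((far_corner n)(n := t)) l = y ((\<lambda>_. 0)(0 := t)) l"
      using m yi[OF segment_in_cube(1)[OF t]] joint unfolding \<tau>'_def by simp
  qed
  ultimately show ?thesis by (rule that)
qed

section \<open>Directions of edges\<close>

lemma face_incl_in_cube:
  assumes "f \<in> cube n" "j \<le> n" "0 \<le> e" "e \<le> 1"
  shows "face_incl j e f \<in> cube (Suc n)"
proof -
  have "0 \<le> face_incl j e f i \<and> face_incl j e f i \<le> 1" for i
    using cube_coordinate[OF assms(1)] assms(3,4) by (simp add: face_incl_def)
  moreover have "face_incl j e f i = 0" if "Suc n \<le> i" for i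
    using assms(1,2) that by (simp add: face_incl_def cube_def)
  ultimately show ?thesis by (simp add: cube_def)
qed

locale k_cube =
  fixes k :: nat and T :: "nat \<Rightarrow> 'b::topological_space cubed_space" and p :: "(nat \<Rightarrow> 'b) \<Rightarrow> 'a::topological_space"
    and X :: "'a cubed_space"
  assumes k_cube: "k_cube_complex k T p X"
begin

abbreviation P :: "(nat \<Rightarrow> 'b) cubed_space" where "P \<equiv> tree_product k T"

abbreviation proj :: "nat \<Rightarrow> ((nat \<Rightarrow> real) \<Rightarrow> nat \<Rightarrow> 'b) \<Rightarrow> (nat \<Rightarrow> real) \<Rightarrow> 'a" where
  "proj n \<tau> \<equiv> restrict (p \<circ> \<tau>) (cube n)"

lemma X_complex: "cube_complex X" and X_finite: "finite_complex X"
  and tree_complex: "i \<in> {1..k} \<Longrightarrow> cube_complex (T i)"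
  and universal: "cubical_universal_cover P p X"
  and deck_preserves: "deck_transformation (points P) p g \<Longrightarrow> preserves_factors k T g"
  using k_cube unfolding k_cube_complex_def regular_tree_def tree_def by simp_all

sublocale simply_connected_covering "points P" p "points X"
  using universal cube_complex_locally_path_connected[OF X_complex]
  unfolding cubical_universal_cover_def by unfold_locales auto

lemma cube_in_P: "\<tau> \<in> charmaps P n \<longleftrightarrow> (\<exists>c. product_charmap k T n c \<tau>)"
  by (simp add: tree_product_def)

lemma cube_in_P_iff_lift:
  "\<tau> \<in> charmaps P n \<longleftrightarrow> \<tau> \<in> extensional (cube n) \<and> continuous_on (cube n) \<tau> \<and>
     \<tau> ` cube n \<subseteq> points P \<and> proj n \<tau> \<in> charmaps X n"
  using universal unfolding cubical_universal_cover_def by simp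

lemma product_edge_in_P: "x \<in> product_edges k T i \<Longrightarrow> x \<in> charmaps P 1"
  unfolding cube_in_P product_edges_def by blast

lemma lift_cube:
  assumes \<sigma>: "\<sigma> \<in> charmaps X n" and s: "s \<in> cube n" and z: "z \<in> points P" "p z = \<sigma> s"
  obtains \<tau> where "\<tau> \<in> charmaps P n" "proj n \<tau> = \<sigma>" "\<tau> s = z"
proof -
  have c: "\<sigma> \<in> extensional (cube n)" "continuous_on (cube n) \<sigma>" "\<sigma> ` cube n \<subseteq> points X"
    using cube_complex_charmap[OF X_complex \<sigma>] by simp_all
  obtain g where g: "continuous_on (cube n) g" "g ` cube n \<subseteq> points P" "g s = z" "\<And>y. y \<in> cube n \<Longrightarrow> p (g y) = \<sigma> y"
    using liftable_cube[OF c(2,3)] s z unfolding liftable_def by metis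
  have pg: "proj n (restrict g (cube n)) = \<sigma>"
    by (rule extensionalityI[OF _ c(1)]) (use g(4) in auto)
  show ?thesis
  proof (rule that[of "restrict g (cube n)"])
    show "restrict g (cube n) \<in> charmaps P n"
      unfolding cube_in_P_iff_lift pg using g \<sigma> by auto
  qed (use pg g s in auto)
qed

lemma lift_cube_somewhere:
  assumes "\<sigma> \<in> charmaps X n"
  obtains \<tau> where "\<tau> \<in> charmaps P n" "proj n \<tau> = \<sigma>"
proof -
  have 0: "(\<lambda>_. 0) \<in> cube n" by (simp add: cube_def)
  then have "\<sigma> (\<lambda>_. 0) \<in> points X"
    using cube_complex_charmap[OF X_complex assms] by blast
  then obtain z where "z \<in> points P" "p z = \<sigma> (\<lambda>_. 0)"
    using p_image by (metis imageE)
  from lift_cube[OF assms 0 this] show ?thesis using that by metis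
qed

lemma lift_cube_unique:
  assumes \<tau>: "\<tau> \<in> charmaps P n" "\<tau>' \<in> charmaps P n" and eq: "proj n \<tau> = proj n \<tau>'"
    and s: "s \<in> cube n" "\<tau> s = \<tau>' s"
  shows "\<tau> = \<tau>'"
proof (rule extensionalityI[of _ "cube n"])
  show "\<tau> f = \<tau>' f" if "f \<in> cube n" for f
  proof (rule lift_unique[of "cube n" \<tau> \<tau>' s f])
    show "p (\<tau> y) = p (\<tau>' y)" if "y \<in> cube n" for y
      using fun_cong[OF eq, of y] that by simp
  qed (use \<tau> s connected_cube that in \<open>simp_all add: cube_in_P_iff_lift\<close>)
qed (use \<tau> in \<open>simp_all add: cube_in_P_iff_lift\<close>)

lemma cube_in_P_points: "\<tau> \<in> charmaps P n \<Longrightarrow> f \<in> cube n \<Longrightarrow> \<tau> f \<in> points P"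
  by (auto simp: cube_in_P_iff_lift)

lemma proj_face:
  assumes "j \<le> n" "e \<in> {0, 1}"
  shows "proj n (restrict (\<tau> \<circ> face_incl j e) (cube n)) = restrict (proj (Suc n) \<tau> \<circ> face_incl j e) (cube n)"
  using assms by (auto simp: fun_eq_iff face_incl_in_cube)

text \<open>A face of a lift is a lift of a face of \<open>X\<close>, hence a cube of
  \<open>P\<close>; no directions need be tracked.\<close>

lemma face_in_P:
  assumes \<tau>: "\<tau> \<in> charmaps P (Suc n)" and j: "j \<le> n" and e: "e \<in> {0, 1}"
  shows "restrict (\<tau> \<circ> face_incl j e) (cube n) \<in> charmaps P n"
  unfolding cube_in_P_iff_lift
proof (intro conjI)
  have fi: "face_incl j e ` cube n \<subseteq> cube (Suc n)"
    using e by (auto intro!: face_incl_in_cube[OF _ j])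
  have "continuous_on (cube n) (face_incl j e)"
    unfolding face_incl_def
  proof (rule continuous_on_coordinatewise_then_product)
    fix i show "continuous_on (cube n) (\<lambda>f. if i < j then f i else if i = j then e else f (i - 1))"
      by (cases "i < j"; cases "i = j")
        (auto intro: continuous_on_subset[OF continuous_on_product_coordinates])
  qed
  then have "continuous_on (cube n) (\<tau> \<circ> face_incl j e)"
    using \<tau> fi unfolding cube_in_P_iff_lift by (blast intro: continuous_on_compose continuous_on_subset)
  then show "continuous_on (cube n) (restrict (\<tau> \<circ> face_incl j e) (cube n))"
    by simp
  show "restrict (\<tau> \<circ> face_incl j e) (cube n) ` cube n \<subseteq> points P"
    using fi cube_in_P_points[OF \<tau>] by auto
  show "proj n (restrict (\<tau> \<circ> face_incl j e) (cube n)) \<in> charmaps X n"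
    unfolding proj_face[OF j e]
    by (rule cube_complex_face[OF X_complex _ j e]) (use \<tau> cube_in_P_iff_lift in blast)
qed simp

lemma edge_in_P_direction:
  assumes "x \<in> charmaps P 1"
  obtains i where "i \<in> {1..k}" "x \<in> product_edges k T i"
proof -
  obtain c where c: "product_charmap k T 1 c x" using assms unfolding cube_in_P by blast
  then have "c 0 \<in> {1..k}" unfolding product_charmap_def by auto
  with c show ?thesis using that unfolding product_charmap_1_iff by blast
qed

text \<open>An edge moves in its own direction by \<open>product_charmap_varies\<close>, and
  \<open>i\<close> is the only component in which it may move.\<close>

lemma edge_direction_constant:
  assumes x: "x \<in> charmaps P 1"
    and const: "\<And>f g l. f \<in> cube 1 \<Longrightarrow> g \<in> cube 1 \<Longrightarrow> l \<noteq> i \<Longrightarrow> x f l = x g l"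
  shows "x \<in> product_edges k T i"
proof -
  obtain c where c: "product_charmap k T 1 c x" using x unfolding cube_in_P by blast
  have "(\<lambda>_. 0) \<in> cube 1" by (simp add: cube_def)
  from product_charmap_varies[OF tree_complex c this, of 0]
  have "c 0 = i" using const by (metis less_one)
  then show ?thesis using c unfolding product_charmap_1_iff by simp
qed

lemma product_edges_varies:
  assumes "x \<in> product_edges k T i"
  obtains f g where "f \<in> cube 1" "g \<in> cube 1" "x f i \<noteq> x g i"
proof -
  have "(\<lambda>_. 0) \<in> cube 1" by (simp add: cube_def)
  from product_charmap_varies[OF tree_complex assms[unfolded product_edges_def mem_Collect_eq] this, of 0]
  show ?thesis using that by (metis less_one)
qed

text \<open>The deck transformation matching the origins carries all of \<open>x\<close> to
  \<open>y\<close>, by uniqueness of lifts. Acting on each factor separately, it keeps every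
  constant component constant. If \<open>i\<close> and \<open>j\<close> differed, component
  \<open>j\<close> would be constant along \<open>x\<close> but not along \<open>y\<close>.\<close>

lemma lifts_same_direction:
  assumes x: "x \<in> product_edges k T i" and y: "y \<in> product_edges k T j" and eq: "proj 1 x = proj 1 y"
  shows "i = j"
proof (rule ccontr)
  assume ij: "i \<noteq> j"
  let ?o = "\<lambda>_::nat. 0 :: real"
  have o: "?o \<in> cube 1" by (simp add: cube_def)
  note xP = product_edge_in_P[OF x] and yP = product_edge_in_P[OF y]
  have pxy: "p (x f) = p (y f)" if "f \<in> cube 1" for f
    using fun_cong[OF eq, of f] that by simp
  obtain g where g: "deck_transformation (points P) p g" "g (x ?o) = y ?o"
    using deck_transformation_exists[OF cube_in_P_points[OF xP o] cube_in_P_points[OF yP o] pxy[OF o]] .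
  obtain \<gamma> where \<gamma>: "\<And>z i. z \<in> points P \<Longrightarrow> i \<in> {1..k} \<Longrightarrow> g z i = \<gamma> i (z i)"
    using deck_preserves[OF g(1)] unfolding preserves_factors_def by blast
  have g': "continuous_on (points P) g" "g ` points P \<subseteq> points P" "\<And>z. z \<in> points P \<Longrightarrow> p (g z) = p z"
    using g(1) unfolding deck_transformation_def homeomorphism_def by auto
  have x': "continuous_on (cube 1) x" "x ` cube 1 \<subseteq> points P" and y': "continuous_on (cube 1) y" "y ` cube 1 \<subseteq> points P"
    using xP yP unfolding cube_in_P_iff_lift by blast+
  have gx: "g (x f) = y f" if f: "f \<in> cube 1" for f
  proof (rule lift_unique[of "cube 1" "\<lambda>f. g (x f)" y ?o f])
    show "continuous_on (cube 1) (\<lambda>f. g (x f))"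
      by (rule continuous_on_compose2[OF g'(1) x'])
    show "(\<lambda>f. g (x f)) ` cube 1 \<subseteq> points P" using g'(2) x'(2) by blast
    show "p (g (x f)) = p (y f)" if "f \<in> cube 1" for f
      using g'(3) x'(2) pxy[OF that] that by (simp add: image_subset_iff)
  qed (use y' connected_cube o g(2) f in auto)
  obtain f h where fh: "f \<in> cube 1" "h \<in> cube 1" "y f j \<noteq> y h j"
    by (rule product_edges_varies[OF y])
  have jk: "j \<in> {1..k}"
    using y unfolding product_edges_def product_charmap_def by auto
  have "x f j = x h j"
    by (rule product_edges_local[OF x fh(1,2)]) (use ij in simp)
  then have "g (x f) j = g (x h) j"
    using \<gamma>[OF _ jk] cube_in_P_points[OF xP] fh(1,2) by simp
  then show False using gx fh by simp
qed

section \<open>Colours of the edges of the complex, and cubes spanned by coloured paths\<close>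

abbreviation edges :: "nat \<Rightarrow> ((nat \<Rightarrow> real) \<Rightarrow> 'a) set" where
  "edges i \<equiv> colour_class (DG k T p X) i"

lemma edges_def: "edges i = {x \<in> charmaps X 1. \<exists>x'\<in>product_edges k T i. proj 1 x' = x}"
  by (simp add: DG_def)

lemma edges_of_lift: "x \<in> product_edges k T i \<Longrightarrow> proj 1 x \<in> edges i"
  using product_edge_in_P[of x i] unfolding edges_def cube_in_P_iff_lift by blast

lemma edges_disjoint: "x \<in> edges i \<Longrightarrow> x \<in> edges j \<Longrightarrow> i = j"
  unfolding edges_def using lifts_same_direction by blast

text \<open>A colour is defined by some lift; as colours are disjoint, it is the direction of every
  lift.\<close>

lemma lift_edge_direction:
  assumes "x \<in> charmaps P 1" "proj 1 x \<in> edges i"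
  shows "x \<in> product_edges k T i"
proof -
  obtain j where "x \<in> product_edges k T j"
    by (rule edge_in_P_direction[OF assms(1)])
  moreover from this have "j = i"
    using edges_disjoint edges_of_lift assms(2) by blast
  ultimately show ?thesis by simp
qed

lemma edges_Union: "charmaps X 1 = (\<Union>i\<in>{1..k}. edges i)"
proof
  show "charmaps X 1 \<subseteq> (\<Union>i\<in>{1..k}. edges i)"
  proof
    fix x assume "x \<in> charmaps X 1"
    then obtain \<tau> where \<tau>: "\<tau> \<in> charmaps P 1" "proj 1 \<tau> = x" by (rule lift_cube_somewhere)
    obtain i where "i \<in> {1..k}" "\<tau> \<in> product_edges k T i"
      by (rule edge_in_P_direction[OF \<tau>(1)])
    then show "x \<in> (\<Union>i\<in>{1..k}. edges i)" using edges_of_lift \<tau>(2) by blast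
  qed
qed (auto simp: edges_def)

lemma lift_edge:
  assumes x: "x \<in> edges i" and z: "z \<in> points P" "p z = edge_origin x"
  obtains x' where "x' \<in> product_edges k T i" "proj 1 x' = x" "x' (\<lambda>_. 0) = z"
proof -
  have "x \<in> charmaps X 1" "(\<lambda>_. 0) \<in> cube 1" using x by (auto simp: edges_def cube_def)
  from lift_cube[OF this z(1)] z(2) obtain \<tau> where "\<tau> \<in> charmaps P 1" "proj 1 \<tau> = x" "\<tau> (\<lambda>_. 0) = z"
    unfolding edge_origin_def by metis
  then show ?thesis using that lift_edge_direction x by blast
qed

text \<open>The extension of product cubes, steered by an edge downstairs: it is lifted so as to
  start at the far corner of \<open>\<tau>\<close>.\<close>

lemma extend_cube:
  assumes \<tau>: "product_charmap k T n c \<tau>" and x: "x \<in> edges i" and i: "i \<notin> c ` {..<n}"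
    and joint: "edge_origin x = p (\<tau> (far_corner n))"
  obtains \<tau>' where "product_charmap k T (Suc n) (c(n := i)) \<tau>'"
    "\<And>f. f \<in> cube n \<Longrightarrow> \<tau>' f = \<tau> f"
    "\<And>t. 0 \<le> t \<Longrightarrow> t \<le> 1 \<Longrightarrow> p (\<tau>' ((far_corner n)(n := t))) = x ((\<lambda>_. 0)(0 := t))"
proof -
  have "\<tau> (far_corner n) \<in> points P"
    using \<tau> far_corner_in_cube by (intro cube_in_P_points) (auto simp: cube_in_P)
  then obtain x' where x': "x' \<in> product_edges k T i" "proj 1 x' = x" "x' (\<lambda>_. 0) = \<tau> (far_corner n)"
    using lift_edge[OF x] joint by metis
  obtain \<tau>' where \<tau>': "product_charmap k T (Suc n) (c(n := i)) \<tau>'"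
    "\<And>f. f \<in> cube n \<Longrightarrow> \<tau>' f = \<tau> f"
    "\<And>t. 0 \<le> t \<Longrightarrow> t \<le> 1 \<Longrightarrow> \<tau>' ((far_corner n)(n := t)) = x' ((\<lambda>_. 0)(0 := t))"
    by (rule product_charmap_extend[OF \<tau> x'(1) i x'(3)]) (rule that)
  show ?thesis
  proof (rule that[OF \<tau>'(1,2)])
    show "p (\<tau>' ((far_corner n)(n := t))) = x ((\<lambda>_. 0)(0 := t))" if "0 \<le> t" "t \<le> 1" for t
      using \<tau>'(3)[OF that] fun_cong[OF x'(2), of "(\<lambda>_. 0)(0 := t)"] segment_in_cube(1)[OF that] by simp
  qed
qed

end

section \<open>Squares and reversed edges\<close>

lemma cube_1_eq: "f \<in> cube 1 \<Longrightarrow> f = (\<lambda>_. 0)(0 := f 0)"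
  by (auto simp: cube_def fun_eq_iff)

lemma face_incl_point_1:
  assumes "f \<in> cube 1"
  shows "face_incl 1 e f = (\<lambda>_. 0)(0 := f 0, 1 := e)" "face_incl 0 e f = (\<lambda>_. 0)(0 := e, 1 := f 0)"
  using assms by (auto simp: cube_def face_incl_def fun_eq_iff)

lemma face_incl_point_2:
  "face_incl 2 e ((\<lambda>_. 0)(0 := a, 1 := b)) = (\<lambda>_. 0)(0 := a, 1 := b, 2 := e)"
  "face_incl 1 e ((\<lambda>_. 0)(0 := a, 1 := b)) = (\<lambda>_. 0)(0 := a, 1 := e, 2 := b)"
  "face_incl 0 e ((\<lambda>_. 0)(0 := a, 1 := b)) = (\<lambda>_. 0)(0 := e, 1 := a, 2 := b)"
  by (auto simp: face_incl_def fun_eq_iff)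

lemma boundary_edge_apply:
  assumes "f \<in> cube 1"
  shows "bottom_edge \<sigma> f = \<sigma> ((\<lambda>_. 0)(0 := f 0, 1 := 0))" "top_edge \<sigma> f = \<sigma> ((\<lambda>_. 0)(0 := f 0, 1 := 1))"
    "left_edge \<sigma> f = \<sigma> ((\<lambda>_. 0)(0 := 0, 1 := f 0))" "right_edge \<sigma> f = \<sigma> ((\<lambda>_. 0)(0 := 1, 1 := f 0))"
  using assms unfolding bottom_edge_def top_edge_def left_edge_def right_edge_def
  by (simp_all add: face_incl_point_1 del: One_nat_def)

lemma boundary_edge_extensional:
  "bottom_edge \<sigma> \<in> extensional (cube 1)" "top_edge \<sigma> \<in> extensional (cube 1)"
  "left_edge \<sigma> \<in> extensional (cube 1)" "right_edge \<sigma> \<in> extensional (cube 1)"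
  by (simp_all add: bottom_edge_def top_edge_def left_edge_def right_edge_def del: One_nat_def)

lemma edge_points_in_cube: "(\<lambda>_. 0) \<in> cube 1" "(\<lambda>_. 0)(0 := 1) \<in> cube 1"
  by (auto simp: cube_def)

lemma boundary_edge_endpoints:
  "edge_origin (bottom_edge \<sigma>) = edge_origin (left_edge \<sigma>)"
  "edge_terminus (bottom_edge \<sigma>) = edge_origin (right_edge \<sigma>)"
  "edge_terminus (left_edge \<sigma>) = edge_origin (top_edge \<sigma>)"
  "edge_terminus (top_edge \<sigma>) = edge_terminus (right_edge \<sigma>)"
  unfolding edge_origin_def edge_terminus_def
  by (simp_all add: boundary_edge_apply edge_points_in_cube del: One_nat_def)

lemma cube_coordinates_in_square:
  assumes "f \<in> cube 1"
  shows "(\<lambda>_. 0)(0 := f 0, 1 := 0) \<in> cube 2" "(\<lambda>_. 0)(0 := f 0, 1 := 1) \<in> cube 2"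
    "(\<lambda>_. 0)(0 := 0, 1 := f 0) \<in> cube 2" "(\<lambda>_. 0)(0 := 1, 1 := f 0) \<in> cube 2"
  by (rule segment_in_cube(2); simp add: cube_coordinate[OF assms])+

lemma cube_symmetriesI:
  "\<pi> permutes {..<n} \<Longrightarrow>
    (\<lambda>f i. if i < n then (if r i then 1 - f (\<pi> i) else f (\<pi> i)) else 0) \<in> cube_symmetries n"
  unfolding cube_symmetries_def by (intro CollectI exI conjI) (assumption, rule refl)

text \<open>The same cell under the symmetry that exchanges its two coordinates. It makes the swap
  of paths an involution.\<close>

lemma transposed_square:
  assumes "cube_complex X" "\<sigma> \<in> charmaps X 2"
  obtains \<sigma>' where "\<sigma>' \<in> charmaps X 2" "bottom_edge \<sigma>' = left_edge \<sigma>" "right_edge \<sigma>' = top_edge \<sigma>"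
    "left_edge \<sigma>' = bottom_edge \<sigma>" "top_edge \<sigma>' = right_edge \<sigma>"
proof -
  define s :: "(nat \<Rightarrow> real) \<Rightarrow> nat \<Rightarrow> real"
    where "s = (\<lambda>f i. if i < 2 then f (Transposition.transpose 0 1 i) else 0)"
  have "Transposition.transpose 0 (1::nat) permutes {..<2}"
    by (rule permutes_swap_id) auto
  from cube_symmetriesI[OF this, of "\<lambda>_. False"] have "s \<in> cube_symmetries 2"
    unfolding s_def by (simp only: if_False)
  then have m: "restrict (\<sigma> \<circ> s) (cube 2) \<in> charmaps X 2" (is "?\<sigma> \<in> _")
    by (rule cube_complex_symmetry[OF assms])
  have s: "s ((\<lambda>_. 0)(0 := a, 1 := b)) = (\<lambda>_. 0)(0 := b, 1 := a)" for a b
    by (auto simp: s_def fun_eq_iff Transposition.transpose_def less_2_cases_iff)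
  show ?thesis
  proof (rule that[OF m])
    show "bottom_edge ?\<sigma> = left_edge \<sigma>" "right_edge ?\<sigma> = top_edge \<sigma>"
      "left_edge ?\<sigma> = bottom_edge \<sigma>" "top_edge ?\<sigma> = right_edge \<sigma>"
      by (rule extensionalityI[of _ "cube 1"]; simp add: boundary_edge_extensional boundary_edge_apply
          cube_coordinates_in_square s del: One_nat_def)+
  qed
qed

section \<open>Orientations of edges, finiteness, and the edges of a 3-cube\<close>

lemma edge_reverse_cases:
  assumes "s \<in> cube_symmetries 1" "x \<in> extensional (cube 1)"
  shows "restrict (x \<circ> s) (cube 1) \<in> {x, edge_reverse x}"
proof -
  obtain \<pi> r where \<pi>: "\<pi> permutes {..<1::nat}" and
    s: "s = (\<lambda>f i. if i < 1 then (if r i then 1 - f (\<pi> i) else f (\<pi> i)) else 0)"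
    using assms(1) unfolding cube_symmetries_def by blast
  have "\<pi> 0 = 0" using permutes_in_image[OF \<pi>, of 0] by simp
  then have s': "s f = (\<lambda>_. 0)(0 := if r 0 then 1 - f 0 else f 0)" for f
    unfolding s by (auto simp: fun_eq_iff)
  show ?thesis
  proof (cases "r 0")
    case True
    then have "restrict (x \<circ> s) (cube 1) = edge_reverse x"
      unfolding edge_reverse_def by (simp add: s' comp_def)
    then show ?thesis by simp
  next
    case False
    have "restrict (x \<circ> s) (cube 1) = x"
      by (rule extensionalityI[OF _ assms(2)]) (use False cube_1_eq in \<open>auto simp: s'\<close>)
    then show ?thesis by simp
  qed
qed

lemma edge_reverse_in_complex:
  assumes "cube_complex X" "x \<in> charmaps X 1"
  shows "edge_reverse x \<in> charmaps X 1"
proof -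
  let ?s = "\<lambda>(f :: nat \<Rightarrow> real) i. if i < 1 then 1 - f i else 0"
  have "?s \<in> cube_symmetries 1"
    using cube_symmetriesI[OF permutes_id, of 1 "\<lambda>_. True"] by (simp only: if_True id_apply)
  moreover have "?s f = (\<lambda>_. 0)(0 := 1 - f 0)" for f by (auto simp: fun_eq_iff)
  ultimately show ?thesis
    using cube_complex_symmetry[OF assms] unfolding edge_reverse_def comp_def by simp
qed

lemma edge_reverse_endpoints:
  "edge_origin (edge_reverse x) = edge_terminus x" "edge_terminus (edge_reverse x) = edge_origin x"
proof -
  have "(\<lambda>_. 0 :: real)((0::nat) := 0) = (\<lambda>_. 0)" by auto
  then show "edge_origin (edge_reverse x) = edge_terminus x" "edge_terminus (edge_reverse x) = edge_origin x"
    using edge_points_in_cube by (simp_all add: edge_origin_def edge_terminus_def edge_reverse_def del: One_nat_def)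
qed

lemma edge_reverse_apply: "f \<in> cube 1 \<Longrightarrow> edge_reverse x f = x ((\<lambda>_. 0)(0 := 1 - f 0))"
  unfolding edge_reverse_def by (simp only: restrict_apply')

lemma edge_reverse_image: "edge_reverse x ` open_cube 1 = x ` open_cube 1"
proof -
  let ?r = "\<lambda>f :: nat \<Rightarrow> real. (\<lambda>_. 0 :: real)((0::nat) := 1 - f 0)"
  have r: "?r f \<in> open_cube 1" "?r (?r f) = f" if "f \<in> open_cube 1" for f
    using that by (auto simp: open_cube_def fun_eq_iff)
  have "open_cube 1 \<subseteq> cube 1" by (auto simp: open_cube_def cube_def less_imp_le)
  then have e: "edge_reverse x f = x (?r f)" if "f \<in> open_cube 1" for f
    using that by (intro edge_reverse_apply) blast
  show ?thesis
  proof
    show "edge_reverse x ` open_cube 1 \<subseteq> x ` open_cube 1" using e r by auto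
    show "x ` open_cube 1 \<subseteq> edge_reverse x ` open_cube 1"
    proof (rule image_subsetI)
      fix f assume f: "f \<in> open_cube 1"
      have "x f = edge_reverse x (?r f)" using e[OF r(1)[OF f]] r(2)[OF f] by simp
      then show "x f \<in> edge_reverse x ` open_cube 1" using r(1)[OF f] by (rule image_eqI)
    qed
  qed
qed

text \<open>Characteristic maps of one cell differ by a symmetry, and the 1-cube has only the
  identity and the reversal. The two resulting maps differ, as \<open>x\<close> is injective on the
  open edge.\<close>

lemma edge_cell:
  assumes X: "cube_complex X" and x: "x \<in> charmaps X 1"
  shows "{z \<in> charmaps X 1. z ` open_cube 1 = x ` open_cube 1} = {x, edge_reverse x}" "x \<noteq> edge_reverse x"
proof -
  let ?u = "\<lambda>t. (\<lambda>_. 0 :: real)((0::nat) := t)"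
  have u: "?u t \<in> open_cube 1" if "0 < t" "t < 1" for t
    using that by (auto simp: open_cube_def)
  have xe: "x \<in> extensional (cube 1)" and inj: "inj_on x (open_cube 1)"
    using cube_complex_charmap[OF X x] by simp_all
  show "{z \<in> charmaps X 1. z ` open_cube 1 = x ` open_cube 1} = {x, edge_reverse x}"
  proof (intro equalityI subsetI)
    fix z assume z: "z \<in> {z \<in> charmaps X 1. z ` open_cube 1 = x ` open_cube 1}"
    have "x (?u (1/2)) \<in> x ` open_cube 1 \<inter> z ` open_cube 1"
      using z u[of "1/2"] by auto
    then have "x ` open_cube 1 \<inter> z ` open_cube 1 \<noteq> {}" by blast
    then obtain s where s: "s \<in> cube_symmetries 1" "z = restrict (x \<circ> s) (cube 1)"
      using cube_complex_same_cell[OF X x, of z 1] z by auto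
    show "z \<in> {x, edge_reverse x}" unfolding s(2) by (rule edge_reverse_cases[OF s(1) xe])
  next
    fix z assume "z \<in> {x, edge_reverse x}"
    then consider "z = x" | "z = edge_reverse x" by blast
    then show "z \<in> {z \<in> charmaps X 1. z ` open_cube 1 = x ` open_cube 1}"
      by cases (simp_all add: x edge_reverse_in_complex[OF X x] edge_reverse_image del: One_nat_def)
  qed
  show "x \<noteq> edge_reverse x"
  proof
    assume "x = edge_reverse x"
    \<comment> \<open>Reversal exchanges \<open>1/4\<close> and \<open>3/4\<close>; only the
      midpoint would be fixed.\<close>
    then have "x (?u (1/4)) = edge_reverse x (?u (1/4))" by (rule fun_cong)
    also have "?u (1/4) \<in> cube 1" by (rule segment_in_cube(1)) simp_all
    then have "edge_reverse x (?u (1/4)) = x (?u (1 - ?u (1/4) 0))"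
      by (rule edge_reverse_apply)
    also have "\<dots> = x (?u (3/4))" by simp
    finally have "?u (1/4) = ?u (3/4)"
      by (rule inj_onD[OF inj]) (intro u; simp)+
    then have "?u (1/4) 0 = ?u (3/4) 0" by (rule fun_cong)
    then show False by simp
  qed
qed

text \<open>\<open>finite_complex\<close> counts open cells, and each 1-cell carries just two
  oriented edges.\<close>

lemma finite_oriented_edges:
  assumes X: "cube_complex X" "finite_complex X"
  shows "finite (charmaps X 1)"
proof -
  have "finite (cells X 1)" using X(2) unfolding finite_complex_def by (rule finite_subset[rotated]) auto
  moreover have "finite {z \<in> charmaps X 1. z ` open_cube 1 = c}" if "c \<in> cells X 1" for c
    using that edge_cell(1)[OF X(1)] unfolding cells_def by auto
  ultimately have "finite (\<Union>c\<in>cells X 1. {z \<in> charmaps X 1. z ` open_cube 1 = c})" by blast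
  then show ?thesis by (rule finite_subset[rotated]) (auto simp: cells_def)
qed

lemma finite_vertices:
  assumes "finite_complex X"
  shows "finite (vertices X)"
proof -
  \<comment> \<open>The open 0-cube is one point, so a 0-cell is a singleton and
    \<open>the_elem\<close> recovers its vertex.\<close>
  have "open_cube 0 = {\<lambda>_. 0}" by (auto simp: open_cube_def)
  then have "vertices X \<subseteq> the_elem ` cells X 0"
    by (force simp: vertices_def cells_def image_iff)
  moreover have "finite (cells X 0)"
    using assms unfolding finite_complex_def by (rule finite_subset[rotated]) auto
  ultimately show ?thesis by (meson finite_imageI finite_subset)
qed

lemma edge_endpoints_in_vertices:
  assumes "cube_complex X" "x \<in> charmaps X 1"
  shows "edge_origin x \<in> vertices X" "edge_terminus x \<in> vertices X"
proof -
  have 0: "(\<lambda>_. 0) \<in> cube 0" by (simp add: cube_def)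
  have face: "restrict (x \<circ> face_incl 0 e) (cube 0) \<in> charmaps X 0" if "e \<in> {0, 1}" for e
    using cube_complex_face[OF assms(1), of x 0 0 e] assms(2) that by simp
  have "face_incl 0 e (\<lambda>_. 0) = (\<lambda>_. 0)(0 := e)" for e
    by (auto simp: face_incl_def)
  moreover have "(\<lambda>_. 0 :: real)((0::nat) := 0) = (\<lambda>_. 0)" by auto
  ultimately have "edge_origin x = restrict (x \<circ> face_incl 0 0) (cube 0) (\<lambda>_. 0)"
    "edge_terminus x = restrict (x \<circ> face_incl 0 1) (cube 0) (\<lambda>_. 0)"
    using 0 by (simp_all add: edge_origin_def edge_terminus_def)
  then show "edge_origin x \<in> vertices X" "edge_terminus x \<in> vertices X"
    unfolding vertices_def mem_Collect_eq using face[of 0] face[of 1] by blast+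
qed

text \<open>Each of the twelve edges of a 3-cube lies on exactly two faces; there is one equation
  for each edge. \<open>F j e\<close> is the face on which coordinate \<open>j\<close> equals
  \<open>e\<close>.\<close>

lemma cube_faces_share_edges:
  fixes \<omega> :: "(nat \<Rightarrow> real) \<Rightarrow> 'a"
  defines "F \<equiv> \<lambda>j e. restrict (\<omega> \<circ> face_incl j e) (cube 2)"
  shows "bottom_edge (F 1 1) = top_edge (F 2 0)" "right_edge (F 1 1) = right_edge (F 0 1)"
    "bottom_edge (F 0 0) = left_edge (F 2 0)" "right_edge (F 0 0) = left_edge (F 1 1)"
    "bottom_edge (F 0 1) = right_edge (F 2 0)" "bottom_edge (F 1 0) = bottom_edge (F 2 0)"
    "right_edge (F 1 0) = left_edge (F 0 1)" "bottom_edge (F 2 1) = top_edge (F 1 0)"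
    "right_edge (F 2 1) = top_edge (F 0 1)" "left_edge (F 0 0) = left_edge (F 1 0)"
    "top_edge (F 2 1) = top_edge (F 1 1)" "left_edge (F 2 1) = top_edge (F 0 0)"
  unfolding F_def
  by (rule extensionalityI[of _ "cube 1"]; simp add: boundary_edge_extensional boundary_edge_apply
      cube_coordinates_in_square face_incl_point_2 del: One_nat_def)+

section \<open>The digraph\<close>

context k_cube
begin

lemma proj_boundary_edge:
  "proj 1 (bottom_edge \<tau>) = bottom_edge (proj 2 \<tau>)" "proj 1 (top_edge \<tau>) = top_edge (proj 2 \<tau>)"
  "proj 1 (left_edge \<tau>) = left_edge (proj 2 \<tau>)" "proj 1 (right_edge \<tau>) = right_edge (proj 2 \<tau>)"
  by (rule extensionalityI[of _ "cube 1"]; simp add: boundary_edge_extensional boundary_edge_apply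
      cube_coordinates_in_square del: One_nat_def)+

lemma boundary_edge_in_P:
  assumes "\<tau> \<in> charmaps P 2"
  shows "bottom_edge \<tau> \<in> charmaps P 1" "top_edge \<tau> \<in> charmaps P 1"
    "left_edge \<tau> \<in> charmaps P 1" "right_edge \<tau> \<in> charmaps P 1"
proof -
  have "\<tau> \<in> charmaps P (Suc 1)" using assms by (simp add: numeral_2_eq_2)
  note face = face_in_P[OF this]
  show "bottom_edge \<tau> \<in> charmaps P 1" "top_edge \<tau> \<in> charmaps P 1"
    "left_edge \<tau> \<in> charmaps P 1" "right_edge \<tau> \<in> charmaps P 1"
    unfolding bottom_edge_def top_edge_def left_edge_def right_edge_def by (rule face; simp)+
qed

text \<open>A horizontal boundary edge moves only the first coordinate of the square and a vertical
  one only the second, so rigidity makes all other components constant.\<close>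

lemma boundary_edge_direction:
  assumes \<tau>: "product_charmap k T 2 c \<tau>"
  shows "bottom_edge \<tau> \<in> product_edges k T (c 0)" "top_edge \<tau> \<in> product_edges k T (c 0)"
    "left_edge \<tau> \<in> product_edges k T (c 1)" "right_edge \<tau> \<in> product_edges k T (c 1)"
proof -
  have "\<tau> \<in> charmaps P 2" using \<tau> unfolding cube_in_P by blast
  note edges = boundary_edge_in_P[OF this]
  show "bottom_edge \<tau> \<in> product_edges k T (c 0)" "top_edge \<tau> \<in> product_edges k T (c 0)"
    "left_edge \<tau> \<in> product_edges k T (c 1)" "right_edge \<tau> \<in> product_edges k T (c 1)"
    by (rule edge_direction_constant, rule edges, simp only: boundary_edge_apply,
        rule product_charmap_local[OF \<tau>]; (simp only: cube_coordinates_in_square)?;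
        auto simp: less_2_cases_iff)+
qed

text \<open>A square of the product of trees is determined by its bottom and right edges, because every
  coordinate of the product depends on one coordinate of the square only.\<close>

lemma square_unique:
  assumes \<sigma>: "\<sigma> \<in> charmaps X 2" "\<sigma>' \<in> charmaps X 2"
    and bottom: "bottom_edge \<sigma> = bottom_edge \<sigma>'" and right: "right_edge \<sigma> = right_edge \<sigma>'"
  shows "\<sigma> = \<sigma>'"
proof -
  let ?u = "(\<lambda>_. 0 :: real)((0::nat) := 1)"
  \<comment> \<open>The common corner of the bottom and right edges. Both squares are lifted through
    one point above it, so that both pairs of edges have equal lifts.\<close>
  let ?v = "(\<lambda>_. 0 :: real)((0::nat) := 1, 1 := 0)"
  have v: "?v \<in> cube 2" by (rule segment_in_cube(2)) simp_all
  obtain \<tau> where \<tau>: "\<tau> \<in> charmaps P 2" "proj 2 \<tau> = \<sigma>" by (rule lift_cube_somewhere[OF \<sigma>(1)])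
  have "\<sigma> ?v = \<sigma>' ?v"
    using fun_cong[OF bottom, of ?u] by (simp add: boundary_edge_apply edge_points_in_cube del: One_nat_def)
  then have "p (\<tau> ?v) = \<sigma>' ?v" using fun_cong[OF \<tau>(2), of ?v] v by simp
  then obtain \<tau>' where \<tau>': "\<tau>' \<in> charmaps P 2" "proj 2 \<tau>' = \<sigma>'" "\<tau>' ?v = \<tau> ?v"
    by (rule lift_cube[OF \<sigma>(2) v cube_in_P_points[OF \<tau>(1) v]]) (rule that)
  have b: "bottom_edge \<tau> = bottom_edge \<tau>'"
  proof (rule lift_cube_unique[OF boundary_edge_in_P(1)[OF \<tau>(1)] boundary_edge_in_P(1)[OF \<tau>'(1)]])
    show "proj 1 (bottom_edge \<tau>) = proj 1 (bottom_edge \<tau>')"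
      unfolding proj_boundary_edge \<tau>(2) \<tau>'(2) by (rule bottom)
    show "?u \<in> cube 1" by (rule edge_points_in_cube)
    show "bottom_edge \<tau> ?u = bottom_edge \<tau>' ?u"
      using \<tau>'(3) by (simp add: boundary_edge_apply edge_points_in_cube del: One_nat_def)
  qed
  have r: "right_edge \<tau> = right_edge \<tau>'"
  proof (rule lift_cube_unique[OF boundary_edge_in_P(4)[OF \<tau>(1)] boundary_edge_in_P(4)[OF \<tau>'(1)]])
    show "proj 1 (right_edge \<tau>) = proj 1 (right_edge \<tau>')"
      unfolding proj_boundary_edge \<tau>(2) \<tau>'(2) by (rule right)
    show "(\<lambda>_. 0) \<in> cube 1" by (rule edge_points_in_cube)
    show "right_edge \<tau> (\<lambda>_. 0) = right_edge \<tau>' (\<lambda>_. 0)"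
      using \<tau>'(3) by (simp add: boundary_edge_apply edge_points_in_cube del: One_nat_def)
  qed
  obtain c c' where c: "product_charmap k T 2 c \<tau>" and c': "product_charmap k T 2 c' \<tau>'"
    using \<tau>(1) \<tau>'(1) unfolding cube_in_P by blast
  have "c 0 = c' 0" "c 1 = c' 1"
    using lifts_same_direction[OF boundary_edge_direction(1)[OF c] boundary_edge_direction(1)[OF c']]
      lifts_same_direction[OF boundary_edge_direction(4)[OF c] boundary_edge_direction(4)[OF c']] b r by simp_all
  moreover have "c 0 \<noteq> c 1" using c unfolding product_charmap_def by (auto dest: inj_onD)
  ultimately have cc: "c 0 = c' 0" "c 1 = c' 1" "c 0 \<noteq> c 1" by auto
  have "\<tau> f l = \<tau>' f l" if f: "f \<in> cube 2" for f l
  proof -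
    let ?f = "\<lambda>i. (\<lambda>_. 0 :: real)((0::nat) := f i)"
    have fi: "?f i \<in> cube 1" for i
      by (rule segment_in_cube(1)) (rule cube_coordinate[OF f])+
    note sq = cube_coordinates_in_square[OF fi]
    show ?thesis
    \<comment> \<open>Component \<open>c 1\<close> is read off the right edge and all others, the
      constant ones included, off the bottom edge.\<close>
    proof (cases "l = c 1")
      case True
      have "\<tau> f l = \<tau> ((\<lambda>_. 0)(0 := 1, 1 := f 1)) l"
        using sq(4)[of 1] cc True by (intro product_charmap_local[OF c f]) (auto simp: less_2_cases_iff)
      also have "\<dots> = right_edge \<tau> (?f 1) l"
        by (simp add: boundary_edge_apply(4)[OF fi] del: One_nat_def)
      also have "\<dots> = right_edge \<tau>' (?f 1) l" unfolding r ..
      also have "\<dots> = \<tau>' ((\<lambda>_. 0)(0 := 1, 1 := f 1)) l"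
        by (simp add: boundary_edge_apply(4)[OF fi] del: One_nat_def)
      also have "\<dots> = \<tau>' f l"
        using sq(4)[of 1] cc True by (intro product_charmap_local[OF c' _ f]) (auto simp: less_2_cases_iff)
      finally show ?thesis .
    next
      case False
      have "\<tau> f l = \<tau> ((\<lambda>_. 0)(0 := f 0, 1 := 0)) l"
        using sq(1)[of 0] cc False by (intro product_charmap_local[OF c f]) (auto simp: less_2_cases_iff)
      also have "\<dots> = bottom_edge \<tau> (?f 0) l"
        by (simp add: boundary_edge_apply(1)[OF fi] del: One_nat_def)
      also have "\<dots> = bottom_edge \<tau>' (?f 0) l" unfolding b ..
      also have "\<dots> = \<tau>' ((\<lambda>_. 0)(0 := f 0, 1 := 0)) l"
        by (simp add: boundary_edge_apply(1)[OF fi] del: One_nat_def)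
      also have "\<dots> = \<tau>' f l"
        using sq(1)[of 0] cc False by (intro product_charmap_local[OF c' _ f]) (auto simp: less_2_cases_iff)
      finally show ?thesis .
    qed
  qed
  then have "\<tau> f = \<tau>' f" if "f \<in> cube 2" for f using that by (intro ext)
  then have "proj 2 \<tau> = proj 2 \<tau>'" by (intro restrict_ext) (simp only: comp_apply)
  then show ?thesis using \<tau>(2) \<tau>'(2) by simp
qed

text \<open>A lift of \<open>x\<close> is a product 1-cube, and \<open>y\<close> extends it at its
  far corner. The lift and its directions are returned so that a third edge can be attached.\<close>

lemma square_lift_exists:
  assumes x: "x \<in> edges i" and y: "y \<in> edges j" and ij: "i \<noteq> j" and joint: "edge_terminus x = edge_origin y"
  obtains \<tau> c where "product_charmap k T 2 c \<tau>" "c 0 = i" "c 1 = j"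
    "bottom_edge (proj 2 \<tau>) = x" "right_edge (proj 2 \<tau>) = y"
proof -
  have xy: "x \<in> extensional (cube 1)" "y \<in> extensional (cube 1)"
    using x y cube_complex_charmap[OF X_complex] unfolding edges_def by blast+
  obtain x' where x': "product_charmap k T 1 (\<lambda>_. i) x'" "proj 1 x' = x"
    using x unfolding edges_def product_edges_def by blast
  have fc: "far_corner 1 = (\<lambda>_. 0)(0 := 1)" by (auto simp: far_corner_def)
  have "edge_origin y = p (x' (far_corner 1))"
    using joint fun_cong[OF x'(2), of "(\<lambda>_. 0)(0 := 1)"] edge_points_in_cube
    unfolding fc edge_terminus_def by simp
  moreover have "j \<notin> (\<lambda>_. i) ` {..<1::nat}" using ij by auto
  ultimately obtain \<tau> where \<tau>: "product_charmap k T (Suc 1) ((\<lambda>_. i)(1 := j)) \<tau>"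
    "\<And>f. f \<in> cube 1 \<Longrightarrow> \<tau> f = x' f"
    "\<And>t. 0 \<le> t \<Longrightarrow> t \<le> 1 \<Longrightarrow> p (\<tau> ((far_corner 1)(1 := t))) = y ((\<lambda>_. 0)(0 := t))"
    using extend_cube[OF x'(1) y] by metis
  show ?thesis
  proof (rule that[of "(\<lambda>_. i)(1 := j)" \<tau>])
    show "product_charmap k T 2 ((\<lambda>_. i)(1 := j)) \<tau>" using \<tau>(1) by (simp add: numeral_2_eq_2)
    show "bottom_edge (proj 2 \<tau>) = x"
    proof (rule extensionalityI[OF boundary_edge_extensional(1) xy(1)])
      fix f :: "nat \<Rightarrow> real" assume f: "f \<in> cube 1"
      have "(\<lambda>_. 0)(0 := f 0, 1 := 0) = f" using f by (auto simp: cube_def fun_eq_iff)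
      then show "bottom_edge (proj 2 \<tau>) f = x f"
        using \<tau>(2)[OF f] fun_cong[OF x'(2), of f] f cube_coordinates_in_square(1)[OF f]
        unfolding boundary_edge_apply[OF f] by simp
    qed
    show "right_edge (proj 2 \<tau>) = y"
    proof (rule extensionalityI[OF boundary_edge_extensional(4) xy(2)])
      fix f :: "nat \<Rightarrow> real" assume f: "f \<in> cube 1"
      show "right_edge (proj 2 \<tau>) f = y f"
        using \<tau>(3)[OF cube_coordinate[OF f], of 0] cube_coordinates_in_square(4)[OF f]
        unfolding boundary_edge_apply[OF f] fc cube_1_eq[OF f, symmetric] by simp
    qed
  qed auto
qed

lemma square_exists:
  assumes "x \<in> edges i" "y \<in> edges j" "i \<noteq> j" "edge_terminus x = edge_origin y"
  obtains \<sigma> where "\<sigma> \<in> charmaps X 2" "bottom_edge \<sigma> = x" "right_edge \<sigma> = y"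
proof -
  obtain \<tau> c where "product_charmap k T 2 c \<tau>" "bottom_edge (proj 2 \<tau>) = x" "right_edge (proj 2 \<tau>) = y"
    by (rule square_lift_exists[OF assms])
  moreover from this(1) have "proj 2 \<tau> \<in> charmaps X 2"
    using cube_in_P cube_in_P_iff_lift by blast
  ultimately show ?thesis using that by blast
qed

text \<open>Opposite sides of a lifted square have the same direction, so they project to the same
  colour.\<close>

lemma square_colours:
  assumes \<sigma>: "\<sigma> \<in> charmaps X 2" and "bottom_edge \<sigma> \<in> edges i" "right_edge \<sigma> \<in> edges j"
  shows "left_edge \<sigma> \<in> edges j" "top_edge \<sigma> \<in> edges i"
proof -
  obtain \<tau> where \<tau>: "\<tau> \<in> charmaps P 2" "proj 2 \<tau> = \<sigma>" by (rule lift_cube_somewhere[OF \<sigma>])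
  obtain c where c: "product_charmap k T 2 c \<tau>" using \<tau>(1) unfolding cube_in_P by blast
  note e = boundary_edge_direction[OF c, THEN edges_of_lift, unfolded proj_boundary_edge \<tau>(2)]
  have "c 0 = i" "c 1 = j"
    using edges_disjoint e(1,4) assms(2,3) by blast+
  then show "left_edge \<sigma> \<in> edges j" "top_edge \<sigma> \<in> edges i" using e(2,3) by simp_all
qed

text \<open>The path \<open>x\<close>, \<open>y\<close>, \<open>z\<close> runs from the origin to
  the far corner of the cube, along coordinates \<open>0\<close>, \<open>1\<close>, \<open>2\<close>
  in this order. Its first two edges bound the face where coordinate \<open>2\<close> is
  \<open>0\<close>; its last edge lies where coordinates \<open>0\<close> and \<open>1\<close> are
  \<open>1\<close>.\<close>

lemma three_cube_exists:
  assumes x: "x \<in> edges i" and y: "y \<in> edges j" and z: "z \<in> edges l"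
    and ijl: "i \<noteq> j" "j \<noteq> l" "i \<noteq> l"
    and joint: "edge_terminus x = edge_origin y" "edge_terminus y = edge_origin z"
  obtains \<omega> where "\<omega> \<in> charmaps X 3" "bottom_edge (restrict (\<omega> \<circ> face_incl 2 0) (cube 2)) = x"
    "right_edge (restrict (\<omega> \<circ> face_incl 2 0) (cube 2)) = y"
    "right_edge (restrict (\<omega> \<circ> face_incl 0 1) (cube 2)) = z"
proof -
  obtain \<tau> c where \<tau>: "product_charmap k T 2 c \<tau>" "c 0 = i" "c 1 = j"
    "bottom_edge (proj 2 \<tau>) = x" "right_edge (proj 2 \<tau>) = y"
    by (rule square_lift_exists[OF x y ijl(1) joint(1)])
  have fc: "far_corner 2 = (\<lambda>_. 0)(0 := 1, 1 := 1)" by (auto simp: far_corner_def fun_eq_iff)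
  have fc2: "far_corner 2 \<in> cube 2" by (rule far_corner_in_cube)
  have "edge_origin z = right_edge (proj 2 \<tau>) ((\<lambda>_. 0)(0 := 1))"
    using joint(2) \<tau>(5) by (simp add: edge_terminus_def)
  also have "\<dots> = p (\<tau> (far_corner 2))"
    using fc2 by (simp add: boundary_edge_apply edge_points_in_cube fc del: One_nat_def)
  finally have "edge_origin z = p (\<tau> (far_corner 2))" .
  moreover have "l \<notin> c ` {..<2}" using \<tau> ijl by (auto simp: less_2_cases_iff)
  ultimately obtain \<tau>' where \<tau>': "product_charmap k T (Suc 2) (c(2 := l)) \<tau>'"
    "\<And>f. f \<in> cube 2 \<Longrightarrow> \<tau>' f = \<tau> f"
    "\<And>t. 0 \<le> t \<Longrightarrow> t \<le> 1 \<Longrightarrow> p (\<tau>' ((far_corner 2)(2 := t))) = z ((\<lambda>_. 0)(0 := t))"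
    using extend_cube[OF \<tau>(1) z] by metis
  have "product_charmap k T 3 (c(2 := l)) \<tau>'" using \<tau>'(1) by (simp add: eval_nat_numeral)
  then have m: "proj 3 \<tau>' \<in> charmaps X 3"
    using cube_in_P cube_in_P_iff_lift by blast
  have sub: "f \<in> cube 3" if "f \<in> cube 2" for f
    using cube_Suc_subset[OF that] by (simp add: eval_nat_numeral)
  have face: "restrict (proj 3 \<tau>' \<circ> face_incl 2 0) (cube 2) = proj 2 \<tau>"
  proof (rule extensionalityI[of _ "cube 2"])
    fix f :: "nat \<Rightarrow> real" assume f: "f \<in> cube 2"
    have "face_incl 2 0 f = f" using f by (auto simp: face_incl_def cube_def fun_eq_iff)
    then show "restrict (proj 3 \<tau>' \<circ> face_incl 2 0) (cube 2) f = proj 2 \<tau> f"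
      using \<tau>'(2)[OF f] f sub[OF f] by simp
  qed simp_all
  show ?thesis
  proof (rule that[OF m])
    show "right_edge (restrict (proj 3 \<tau>' \<circ> face_incl 0 1) (cube 2)) = z"
    proof (rule extensionalityI[OF boundary_edge_extensional(4)])
      show "z \<in> extensional (cube 1)"
        using z cube_complex_charmap[OF X_complex] unfolding edges_def by blast
      fix f :: "nat \<Rightarrow> real" assume f: "f \<in> cube 1"
      have "(\<lambda>_. 0)(0 := 1, 1 := 1, 2 := f 0) \<in> cube 3"
        using cube_coordinate[OF f] by (auto simp: cube_def)
      then show "right_edge (restrict (proj 3 \<tau>' \<circ> face_incl 0 1) (cube 2)) f = z f"
        using \<tau>'(3)[OF cube_coordinate[OF f], of 0] cube_coordinates_in_square(4)[OF f]
        unfolding boundary_edge_apply[OF f] fc cube_1_eq[OF f, symmetric]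
        by (simp add: face_incl_point_2 del: One_nat_def)
    qed
  qed (use face \<tau>(4,5) in simp_all)
qed

section \<open>The swap of two-paths and the axioms of a digraph\<close>

lemma DG_simps:
  "verts (graph (DG k T p X)) = vertices X" "arcs (graph (DG k T p X)) = charmaps X 1"
  "tail (graph (DG k T p X)) = edge_origin" "head (graph (DG k T p X)) = edge_terminus"
  by (simp_all add: DG_def)

text \<open>\<open>square_unique\<close> makes the \<open>THE\<close> in \<open>path_swap\<close>
  well defined.\<close>

lemma path_swap_square:
  assumes "\<sigma> \<in> charmaps X 2"
  shows "path_swap (DG k T p X) (bottom_edge \<sigma>, right_edge \<sigma>) = (left_edge \<sigma>, top_edge \<sigma>)"
proof -
  have "(THE q. \<exists>\<sigma>'\<in>charmaps X 2. bottom_edge \<sigma>' = bottom_edge \<sigma> \<and> right_edge \<sigma>' = right_edge \<sigma> \<and>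
      q = (left_edge \<sigma>', top_edge \<sigma>')) = (left_edge \<sigma>, top_edge \<sigma>)"
  proof (rule the_equality)
    show "q = (left_edge \<sigma>, top_edge \<sigma>)" if "\<exists>\<sigma>'\<in>charmaps X 2. bottom_edge \<sigma>' = bottom_edge \<sigma> \<and>
      right_edge \<sigma>' = right_edge \<sigma> \<and> q = (left_edge \<sigma>', top_edge \<sigma>')" for q
      using that square_unique[OF _ assms] by metis
  qed (use assms in blast)
  then show ?thesis by (simp add: DG_def)
qed

lemma two_paths_iff:
  "(x, y) \<in> two_paths k (DG k T p X) \<longleftrightarrow>
    (\<exists>i\<in>{1..k}. \<exists>j\<in>{1..k}. i \<noteq> j \<and> x \<in> edges i \<and> y \<in> edges j \<and> edge_terminus x = edge_origin y)"
  unfolding two_paths_def DG_simps by simp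

lemma path_swap_involution:
  assumes "\<sigma> \<in> charmaps X 2"
  shows "path_swap (DG k T p X) (left_edge \<sigma>, top_edge \<sigma>) = (bottom_edge \<sigma>, right_edge \<sigma>)"
proof -
  obtain \<sigma>' where \<sigma>': "\<sigma>' \<in> charmaps X 2" "bottom_edge \<sigma>' = left_edge \<sigma>" "right_edge \<sigma>' = top_edge \<sigma>"
    "left_edge \<sigma>' = bottom_edge \<sigma>" "top_edge \<sigma>' = right_edge \<sigma>"
    by (rule transposed_square[OF X_complex assms])
  show ?thesis using path_swap_square[OF \<sigma>'(1)] unfolding \<sigma>'(2-5) .
qed

text \<open>Presents every two-path by a square whose other boundary path is again a two-path, so
  bijectivity reduces to the swap being its own inverse.\<close>

lemma two_path_square:
  assumes "q \<in> two_paths k (DG k T p X)"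
  obtains \<sigma> where "\<sigma> \<in> charmaps X 2" "q = (bottom_edge \<sigma>, right_edge \<sigma>)"
    "(left_edge \<sigma>, top_edge \<sigma>) \<in> two_paths k (DG k T p X)"
proof -
  obtain x y where q: "q = (x, y)" by (cases q)
  then obtain i j where ij: "i \<in> {1..k}" "j \<in> {1..k}" "i \<noteq> j" "x \<in> edges i" "y \<in> edges j"
    "edge_terminus x = edge_origin y"
    using assms unfolding q two_paths_iff by blast
  then obtain \<sigma> where \<sigma>: "\<sigma> \<in> charmaps X 2" "bottom_edge \<sigma> = x" "right_edge \<sigma> = y"
    using square_exists by metis
  have "left_edge \<sigma> \<in> edges j" "top_edge \<sigma> \<in> edges i"
    using square_colours[OF \<sigma>(1)] \<sigma>(2,3) ij by simp_all
  then have "(left_edge \<sigma>, top_edge \<sigma>) \<in> two_paths k (DG k T p X)"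
    unfolding two_paths_iff using ij boundary_edge_endpoints(3) by metis
  with \<sigma> q show ?thesis using that by blast
qed

lemma path_swap_bij: "bij_betw (path_swap (DG k T p X)) (two_paths k (DG k T p X)) (two_paths k (DG k T p X))"
proof (rule bij_betw_byWitness[where f' = "path_swap (DG k T p X)"])
  show "\<forall>q\<in>two_paths k (DG k T p X). path_swap (DG k T p X) (path_swap (DG k T p X) q) = q"
    by (metis two_path_square path_swap_square path_swap_involution)
  then show "\<forall>q\<in>two_paths k (DG k T p X). path_swap (DG k T p X) (path_swap (DG k T p X) q) = q" .
  show "path_swap (DG k T p X) ` two_paths k (DG k T p X) \<subseteq> two_paths k (DG k T p X)"
    by (metis image_subsetI two_path_square path_swap_square)
  then show "path_swap (DG k T p X) ` two_paths k (DG k T p X) \<subseteq> two_paths k (DG k T p X)" .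
qed

lemma DG_F1: "F1 k (DG k T p X)"
  unfolding F1_def DG_simps
proof (intro ballI impI)
  fix i j x y
  assume ij: "i \<in> {1..k}" "j \<in> {1..k}" and xy: "x \<in> edges i" "y \<in> edges j" "i \<noteq> j \<and> edge_terminus x = edge_origin y"
  then obtain \<sigma> where \<sigma>: "\<sigma> \<in> charmaps X 2" "bottom_edge \<sigma> = x" "right_edge \<sigma> = y"
    using square_exists by metis
  have swap: "path_swap (DG k T p X) (x, y) = (left_edge \<sigma>, top_edge \<sigma>)"
    using path_swap_square[OF \<sigma>(1)] \<sigma>(2,3) by simp
  have "left_edge \<sigma> \<in> edges j" "top_edge \<sigma> \<in> edges i"
    using square_colours[OF \<sigma>(1)] \<sigma>(2,3) xy by simp_all
  moreover have "edge_terminus (left_edge \<sigma>) = edge_origin (top_edge \<sigma>)"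
    "edge_origin (left_edge \<sigma>) = edge_origin x" "edge_terminus (top_edge \<sigma>) = edge_terminus y"
    using boundary_edge_endpoints[of \<sigma>] \<sigma>(2,3) by simp_all
  moreover have "path_swap (DG k T p X) (path_swap (DG k T p X) (x, y)) = (x, y)"
    unfolding swap using path_swap_involution[OF \<sigma>(1)] \<sigma>(2,3) by simp
  ultimately show "(\<exists>!(y', x'). path_swap (DG k T p X) (x, y) = (y', x') \<and> y' \<in> edges j \<and> x' \<in> edges i \<and>
      edge_terminus y' = edge_origin x' \<and> edge_origin y' = edge_origin x \<and> edge_terminus x' = edge_terminus y) \<and>
      path_swap (DG k T p X) (path_swap (DG k T p X) (x, y)) = (x, y)"
    unfolding swap by (intro conjI ex1I[of _ "(left_edge \<sigma>, top_edge \<sigma>)"]) auto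
qed

text \<open>Both ways of reversing the order of colours of \<open>xyz\<close> run over the faces of one 3-cube: three
  faces for the one, the opposite three for the other.\<close>

lemma DG_F2: "F2 k (DG k T p X)"
  unfolding F2_def DG_simps
proof (intro ballI impI)
  fix i j l x y z x1 x2 xa xb y1 y2 ya yb z1 z2 za zb
  let ?s = "path_swap (DG k T p X)"
  assume ijl: "i \<noteq> j \<and> j \<noteq> l \<and> i \<noteq> l" and xyz: "x \<in> edges i" "y \<in> edges j" "z \<in> edges l"
    "edge_terminus x = edge_origin y \<and> edge_terminus y = edge_origin z"
  assume swaps: "?s (x, y) = (ya, xa) \<and> ?s (xa, z) = (za, xb) \<and> ?s (ya, za) = (zb, yb) \<and>
    ?s (y, z) = (z1, y1) \<and> ?s (x, z1) = (z2, x1) \<and> ?s (x1, y1) = (y2, x2)"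
  obtain \<omega> where \<omega>: "\<omega> \<in> charmaps X 3" "bottom_edge (restrict (\<omega> \<circ> face_incl 2 0) (cube 2)) = x"
    "right_edge (restrict (\<omega> \<circ> face_incl 2 0) (cube 2)) = y"
    "right_edge (restrict (\<omega> \<circ> face_incl 0 1) (cube 2)) = z"
    by (rule three_cube_exists[OF xyz(1-3)]) (use ijl xyz(4) in auto)
  define F where "F j e = restrict (\<omega> \<circ> face_incl j e) (cube 2)" for j e
  have "\<omega> \<in> charmaps X (Suc 2)" using \<omega>(1) by (simp add: eval_nat_numeral)
  then have "F j e \<in> charmaps X 2" if "j \<le> 2" "e \<in> {0, 1}" for j e
    unfolding F_def using cube_complex_face[OF X_complex _ that] by blast
  then have s: "?s (bottom_edge (F j e), right_edge (F j e)) = (left_edge (F j e), top_edge (F j e))"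
    if "j \<le> 2" "e \<in> {0, 1}" for j e
    using path_swap_square that by blast
  note F = cube_faces_share_edges[of \<omega>, folded F_def]
  have xyz': "bottom_edge (F 2 0) = x" "right_edge (F 2 0) = y" "right_edge (F 0 1) = z"
    using \<omega>(2-4) unfolding F_def by simp_all
  \<comment> \<open>The swaps with upper indices use the faces \<open>F 2 0\<close>,
    \<open>F 1 1\<close>, \<open>F 0 0\<close> in turn, each starting from edges shared with earlier
    ones. The swaps with lower indices then use the opposite faces \<open>F 0 1\<close>,
    \<open>F 1 0\<close>, \<open>F 2 1\<close>.\<close>
  have a: "left_edge (F 2 0) = ya" "top_edge (F 2 0) = xa"
    using s[of 2 0] swaps xyz' by simp_all
  have b: "left_edge (F 1 1) = za" "top_edge (F 1 1) = xb"
    using s[of 1 1] swaps xyz' F a by simp_all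
  have c: "left_edge (F 0 0) = zb" "top_edge (F 0 0) = yb"
    using s[of 0 0] swaps F a b by simp_all
  have d: "left_edge (F 0 1) = z1" "top_edge (F 0 1) = y1"
    using s[of 0 1] swaps xyz' F by simp_all
  have e: "left_edge (F 1 0) = z2" "top_edge (F 1 0) = x1"
    using s[of 1 0] swaps xyz' F d by simp_all
  have f: "left_edge (F 2 1) = y2" "top_edge (F 2 1) = x2"
    using s[of 2 1] swaps F d e by simp_all
  \<comment> \<open>Both routes end with the same path from the origin to the far corner, along
    coordinates \<open>2\<close>, \<open>1\<close>, \<open>0\<close>; \<open>F(10-12)\<close>
    identify its three edges on the faces of either route.\<close>
  show "x2 = xb \<and> y2 = yb \<and> z2 = zb"
    using b c e f F(10-12) by simp
qed

lemma DG_k_dim_digraph: "k \<ge> 2 \<Longrightarrow> k_dim_digraph k (DG k T p X)"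
proof -
  assume k: "k \<ge> 2"
  have "fin_digraph (graph (DG k T p X))"
    by unfold_locales
      (simp_all add: DG_simps finite_vertices X_finite finite_oriented_edges X_complex edge_endpoints_in_vertices
        del: One_nat_def)
  moreover have "disjoint_family_on edges {1..k}"
    unfolding disjoint_family_on_def using edges_disjoint by blast
  ultimately show ?thesis
    unfolding k_dim_digraph_def DG_simps
    using k edges_Union path_swap_bij DG_F1 DG_F2 by blast
qed

text \<open>The reverse of a lift is a lift of the reverse, hence an edge upstairs, and it is
  constant in the same components.\<close>

lemma edge_reverse_colour:
  assumes "x \<in> edges i"
  shows "edge_reverse x \<in> edges i"
proof -
  obtain x' where x': "x' \<in> product_edges k T i" "proj 1 x' = x" and x: "x \<in> charmaps X 1"
    using assms unfolding edges_def by blast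
  have x'P: "x' \<in> charmaps P 1" by (rule product_edge_in_P[OF x'(1)])
  let ?r = "\<lambda>f :: nat \<Rightarrow> real. (\<lambda>_. 0 :: real)((0::nat) := 1 - f 0)"
  have r: "?r f \<in> cube 1" if "f \<in> cube 1" for f
    using cube_coordinate[OF that] by (intro segment_in_cube(1)) simp_all
  note rev = edge_reverse_apply
  have proj_rev: "proj 1 (edge_reverse x') = edge_reverse x"
  proof (rule extensionalityI[of _ "cube 1"])
    fix f :: "nat \<Rightarrow> real" assume f: "f \<in> cube 1"
    show "proj 1 (edge_reverse x') f = edge_reverse x f"
      using fun_cong[OF x'(2), of "?r f"] r[OF f] f by (simp add: rev del: One_nat_def)
  qed (simp_all add: edge_reverse_def del: One_nat_def)
  have "edge_reverse x' \<in> charmaps P 1"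
    unfolding cube_in_P_iff_lift proj_rev
  proof (intro conjI)
    show "edge_reverse x' \<in> extensional (cube 1)" unfolding edge_reverse_def by (rule restrict_extensional)
    show "edge_reverse x' ` cube 1 \<subseteq> points P"
      by (rule image_subsetI) (simp only: rev cube_in_P_points[OF x'P] r)
    show "edge_reverse x \<in> charmaps X 1" by (rule edge_reverse_in_complex[OF X_complex x])
    have "continuous_on (cube 1) (\<lambda>f. x' (?r f))"
    proof (rule continuous_on_compose2[of "cube 1" x'])
      show "continuous_on (cube 1) x'" using x'P unfolding cube_in_P_iff_lift by blast
      show "continuous_on (cube 1) ?r"
        by (intro continuous_on_coordinates_1 continuous_intros
            continuous_on_subset[OF continuous_on_product_coordinates subset_UNIV])
    qed (use r in blast)
    then show "continuous_on (cube 1) (edge_reverse x')"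
      by (rule continuous_on_eq) (simp only: rev)
  qed
  moreover have "edge_reverse x' f l = edge_reverse x' g l" if "f \<in> cube 1" "g \<in> cube 1" "l \<noteq> i" for f g l
    unfolding rev[OF that(1)] rev[OF that(2)]
    by (rule product_edges_local[OF x'(1) r[OF that(1)] r[OF that(2)] that(3)])
  ultimately have "edge_reverse x' \<in> product_edges k T i" by (rule edge_direction_constant)
  then show ?thesis using edges_of_lift[of "edge_reverse x'" i] unfolding proj_rev by simp
qed

end

text \<open>The conjuncts beyond \<open>k_dim_digraph\<close> tie the digraph to \<open>X\<close>.
  In particular the last one shows that on two-paths the \<open>THE\<close> in
  \<open>path_swap\<close> never falls back to an unspecified value.\<close>

theorem theorem1p3:
  fixes k :: nat
    and X :: "'a::topological_space cubed_space"
    and T :: "nat \<Rightarrow> 'b::topological_space cubed_space"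
    and p :: "(nat \<Rightarrow> 'b) \<Rightarrow> 'a"
  assumes "k \<ge> 2"
    and "k_cube_complex k T p X"
  shows "k_dim_digraph k (DG k T p X)
    \<and> verts (graph (DG k T p X)) = vertices X
    \<and> arcs (graph (DG k T p X)) = oriented_edges X
    \<and> (\<forall>c\<in>cells X 1. \<exists>x y. x \<noteq> y
         \<and> {z \<in> arcs (graph (DG k T p X)). z ` open_cube 1 = c} = {x, y}
         \<and> y = edge_reverse x
         \<and> tail (graph (DG k T p X)) y = head (graph (DG k T p X)) x
         \<and> head (graph (DG k T p X)) y = tail (graph (DG k T p X)) x
         \<and> (\<exists>i\<in>{1..k}. x \<in> colour_class (DG k T p X) i \<and> y \<in> colour_class (DG k T p X) i))
    \<and> (\<forall>(x, y)\<in>two_paths k (DG k T p X).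
         (\<exists>!Q. \<exists>\<sigma>\<in>charmaps X 2. Q = \<sigma> ` open_cube 2 \<and> bottom_edge \<sigma> = x \<and> right_edge \<sigma> = y)
         \<and> (\<forall>\<sigma>\<in>charmaps X 2. bottom_edge \<sigma> = x \<and> right_edge \<sigma> = y \<longrightarrow>
              path_swap (DG k T p X) (x, y) = (left_edge \<sigma>, top_edge \<sigma>)))"
proof -
  interpret k_cube k T p X by unfold_locales (rule assms(2))
  show ?thesis
    unfolding DG_simps
  proof (intro conjI ballI refl)
    show "k_dim_digraph k (DG k T p X)" by (rule DG_k_dim_digraph[OF assms(1)])
  next
    fix c assume "c \<in> cells X 1"
    then obtain x where x: "x \<in> charmaps X 1" and c: "c = x ` open_cube 1"
      unfolding cells_def by blast
    obtain i where i: "i \<in> {1..k}" "x \<in> edges i" using x edges_Union by blast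
    show "\<exists>x y. x \<noteq> y \<and> {z \<in> charmaps X 1. z ` open_cube 1 = c} = {x, y} \<and> y = edge_reverse x
         \<and> edge_origin y = edge_terminus x \<and> edge_terminus y = edge_origin x
         \<and> (\<exists>i\<in>{1..k}. x \<in> edges i \<and> y \<in> edges i)"
      by (rule exI[of _ x], rule exI[of _ "edge_reverse x"], intro conjI bexI[of _ i] refl)
        (use i in \<open>simp_all add: edge_cell[OF X_complex x] c edge_reverse_endpoints edge_reverse_colour
          del: One_nat_def\<close>)
  next
    fix q assume "q \<in> two_paths k (DG k T p X)"
    then obtain \<sigma> where \<sigma>: "\<sigma> \<in> charmaps X 2" "q = (bottom_edge \<sigma>, right_edge \<sigma>)"
      by (rule two_path_square)
    have unique: "\<sigma>' = \<sigma>" if "\<sigma>' \<in> charmaps X 2" "bottom_edge \<sigma>' = bottom_edge \<sigma>" "right_edge \<sigma>' = right_edge \<sigma>" for \<sigma>'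
      by (rule square_unique[OF that(1) \<sigma>(1) that(2,3)])
    show "case q of (x, y) \<Rightarrow>
         (\<exists>!Q. \<exists>\<sigma>\<in>charmaps X 2. Q = \<sigma> ` open_cube 2 \<and> bottom_edge \<sigma> = x \<and> right_edge \<sigma> = y)
         \<and> (\<forall>\<sigma>\<in>charmaps X 2. bottom_edge \<sigma> = x \<and> right_edge \<sigma> = y \<longrightarrow>
              path_swap (DG k T p X) (x, y) = (left_edge \<sigma>, top_edge \<sigma>))"
      unfolding \<sigma>(2) prod.case
    proof (intro conjI ballI impI)
      show "\<exists>!Q. \<exists>\<sigma>'\<in>charmaps X 2. Q = \<sigma>' ` open_cube 2 \<and> bottom_edge \<sigma>' = bottom_edge \<sigma> \<and> right_edge \<sigma>' = right_edge \<sigma>"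
        by (rule ex1I[of _ "\<sigma> ` open_cube 2"]) (use unique \<sigma>(1) in blast)+
      fix \<sigma>' assume "\<sigma>' \<in> charmaps X 2" "bottom_edge \<sigma>' = bottom_edge \<sigma> \<and> right_edge \<sigma>' = right_edge \<sigma>"
      then have "\<sigma>' = \<sigma>" using unique by blast
      then show "path_swap (DG k T p X) (bottom_edge \<sigma>, right_edge \<sigma>) = (left_edge \<sigma>', top_edge \<sigma>')"
        using path_swap_square[OF \<sigma>(1)] by simp
    qed
  qed
qed

end
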